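(* Let $f\in\operatorname{Rec}_2$ and let $\mathcal{P}$ be a setwise $\mathbb{Q}$-free partition of $[0,1)^2$ into rectangles associated with $f$. Then there exists a finite sequence $(r_1,\dots,r_n)$ of restricted shuffles on $\mathcal{P}$ such that $f=r_n\circ\cdots\circ r_1$.
   Context: A rectangle in $\mathbb{R}^d$ is a set $\prod_{i=1}^d[a_i,b_i)$ with $a_i<b_i$ real. $\operatorname{Rec}_d$ is the group of bijections $f$ of $[0,1)^d$ for which there is a finite partition of $[0,1)^d$ into rectangles on each of which $f$ is a translation; such a partition is said to be associated with $f$. Writing $\operatorname{pr}_i$ for the $i$-th coordinate projection and $\lambda$ for Lebesgue measure, a partition $\mathcal{P}$ into rectangles is setwise $\mathbb{Q}$-free if for each $i$ the set $\{\lambda(\operatorname{pr}_i(K)):K\in\mathcal{P}\}$ (as a set, without repetitions) is $\mathbb{Q}$-linearly independent. A restricted shuffle: for a rectangle $P=\prod_j[a_j,b_j)$, an index $i$ and $c\in(a_i,b_i)$, let $P'$ (resp. $P''$) be obtained from $P$ by replacing $[a_i,b_i)$ by $[a_i,c)$ (resp. $[c,b_i)$); the restricted shuffle is translation by $(b_i-c)e_i$ on $P'$, by $-(c-a_i)e_i$ on $P''$, identity outside $P$; it is said to shuffle $P'$ and $P''$. A restricted shuffle on a partition $\mathcal{Q}$ is a restricted shuffle that shuffles two rectangles $P',P''$ both belonging to $\mathcal{Q}$. A sequence $(r_1,\dots,r_n)$ of restricted shuffles on $\mathcal{P}$ is a sequence such that each $r_k$ is a restricted shuffle on the partition $r_{k-1}\circ\cdots\circ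 r_1(\mathcal{P})=\{r_{k-1}\circ\cdots\circ r_1(K):K\in\mathcal{P}\}$. *)

theory Defs
  imports "HOL-Analysis.Analysis"
begin

definition half_open_box :: "real^'n \<Rightarrow> real^'n \<Rightarrow> (real^'n) set" where
  "half_open_box a b = {x. \<forall>j. a$j \<le> x$j \<and> x$j < b$j}"

definition is_rectangle :: "(real^'n) set \<Rightarrow> bool" where
  "is_rectangle K \<longleftrightarrow> (\<exists>a b. (\<forall>j. a$j < b$j) \<and> K = half_open_box a b)"

definition unit_cube :: "(real^'n) set" where
  "unit_cube = half_open_box 0 1"

definition rect_partition :: "(real^'n) set set \<Rightarrow> bool" where
  "rect_partition P \<longleftrightarrow> finite P \<and> (\<forall>K\<in>P. is_rectangle K)
     \<and> (\<forall>K\<in>P. \<forall>L\<in>P. K \<noteq> L \<longrightarrow> K \<inter> L = {}) \<and> \<Union>P = unit_cube"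

definition associated :: "(real^'n \<Rightarrow> real^'n) \<Rightarrow> (real^'n) set set \<Rightarrow> bool" where
  "associated f P \<longleftrightarrow> rect_partition P \<and> (\<forall>K\<in>P. \<exists>v. \<forall>x\<in>K. f x = x + v)"

definition in_Rec :: "(real^'n \<Rightarrow> real^'n) \<Rightarrow> bool" where
  "in_Rec f \<longleftrightarrow> bij_betw f unit_cube unit_cube \<and> (\<exists>P. associated f P)"

definition Q_lin_indep :: "real set \<Rightarrow> bool" where
  "Q_lin_indep S \<longleftrightarrow> (\<forall>T c. finite T \<and> T \<subseteq> S \<and> (\<forall>s\<in>T. c s \<in> \<rat>)
      \<and> (\<Sum>s\<in>T. c s * s) = 0 \<longrightarrow> (\<forall>s\<in>T. c s = 0))"

definition setwise_Q_free :: "(real^'n) set set \<Rightarrow> bool" where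
  "setwise_Q_free P \<longleftrightarrow>
     (\<forall>i. Q_lin_indep {measure lborel ((\<lambda>x. x$i) ` K) | K. K \<in> P})"

definition upd_vec :: "real^'n \<Rightarrow> 'n \<Rightarrow> real \<Rightarrow> real^'n" where
  "upd_vec v i c = (\<chi> j. if j = i then c else v$j)"

definition rshuffle :: "real^'n \<Rightarrow> real^'n \<Rightarrow> 'n \<Rightarrow> real \<Rightarrow> real^'n \<Rightarrow> real^'n" where
  "rshuffle a b i c x =
     (if x \<in> half_open_box a (upd_vec b i c) then x + (b$i - c) *\<^sub>R axis i 1
      else if x \<in> half_open_box (upd_vec a i c) b then x - (c - a$i) *\<^sub>R axis i 1
      else x)"

definition is_rshuffle_on :: "(real^'n) set set \<Rightarrow> (real^'n \<Rightarrow> real^'n) \<Rightarrow> bool" where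
  "is_rshuffle_on Q r \<longleftrightarrow> (\<exists>a b i c. (\<forall>j. a$j < b$j) \<and> a$i < c \<and> c < b$i
      \<and> half_open_box a (upd_vec b i c) \<in> Q \<and> half_open_box (upd_vec a i c) b \<in> Q
      \<and> r = rshuffle a b i c)"

fun rshuffle_seq_on :: "(real^'n) set set \<Rightarrow> (real^'n \<Rightarrow> real^'n) list \<Rightarrow> bool" where
  "rshuffle_seq_on Q [] = True"
| "rshuffle_seq_on Q (r # rs) = (is_rshuffle_on Q r \<and> rshuffle_seq_on ((\<lambda>K. r ` K) ` Q) rs)"

definition comp_seq :: "('a \<Rightarrow> 'a) list \<Rightarrow> 'a \<Rightarrow> 'a" where
  "comp_seq rs = foldl (\<lambda>g r. r \<circ> g) id rs"

end

(*
  Idea.  Independence makes the tiling rigid: if two stacks of tiles have the same total height,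
  they contain equally many tiles of each height, and likewise for widths.  Fix a tile height beta.
  A tile whose bottom lies at y belongs to the lowest layer of tiles of height beta iff beta has
  coefficient 0 in y.  This layer can be pushed down to the bottom side of the rectangle: among the
  tiles below the layer take those with the highest top edge, at height t.  All tiles standing on
  level t are then in the layer, hence of equal height, and along a connected component of the edge
  at level t they have the same widths as the tiles underneath.  So after shuffling them within
  their row, one of them can be shuffled vertically with the tile below it.

  Once a bottom row of constant height is split off, induction applies to the remaining rectangle.
  To make the bottom rows of two tilings consist of the same tiles one has to interchange a tile of
  the bottom row with a tile of the same shape above it: by induction and the transposed argument
  both are brought into a common column along the left side, where they can be interchanged.
*)

theory Submission
  imports Defs
begin

section \<open>Independent lengths and tilings of an interval\<close>

text \<open>Grouping by value writes each sum as a combination of distinct values of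
  \<open>h\<close> with multiplicities as coefficients, so independence allows comparing
  coefficients. Every use of independence in the geometry goes through this fact.\<close>

lemma card_eq_of_sum_eq:
  fixes h :: "'l \<Rightarrow> real"
  assumes L: "finite L" "Q_lin_indep (h ` L)" and AB: "A \<subseteq> L" "B \<subseteq> L"
    and eq: "sum h A = sum h B"
  shows "card {c \<in> A. h c = \<beta>} = card {c \<in> B. h c = \<beta>}"
proof -
  have fin: "finite A" "finite B"
    using AB L(1) finite_subset by auto
  define n where "n D \<gamma> = real (card {c \<in> D. h c = \<gamma>})" for D \<gamma>
  have count: "sum h D = (\<Sum>\<gamma>\<in>h ` L. n D \<gamma> * \<gamma>)" if "D \<subseteq> L" for D
  proof -
    have "finite D"
      using that L(1) finite_subset by auto
    then have "sum h D = (\<Sum>\<gamma>\<in>h ` L. sum h {c \<in> D. h c = \<gamma>})"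
      using that L(1) by (intro sum.group[symmetric]) auto
    also have "\<dots> = (\<Sum>\<gamma>\<in>h ` L. n D \<gamma> * \<gamma>)"
      by (intro sum.cong refl) (simp add: n_def)
    finally show ?thesis .
  qed
  have "(\<Sum>\<gamma>\<in>h ` L. (n A \<gamma> - n B \<gamma>) * \<gamma>) = 0"
    using count[OF AB(1)] count[OF AB(2)] eq by (simp add: left_diff_distrib sum_subtractf)
  moreover have "\<forall>\<gamma>\<in>h ` L. n A \<gamma> - n B \<gamma> \<in> \<rat>"
    by (simp add: n_def)
  ultimately have "finite (h ` L) \<and> h ` L \<subseteq> h ` L \<and> (\<forall>\<gamma>\<in>h ` L. n A \<gamma> - n B \<gamma> \<in> \<rat>)
      \<and> (\<Sum>\<gamma>\<in>h ` L. (n A \<gamma> - n B \<gamma>) * \<gamma>) = 0"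
    using L(1) by (intro conjI) simp_all
  then have "\<forall>\<gamma>\<in>h ` L. n A \<gamma> - n B \<gamma> = 0"
    using L(2)[unfolded Q_lin_indep_def, THEN spec, THEN spec, of "h ` L" "\<lambda>\<gamma>. n A \<gamma> - n B \<gamma>"]
    by (rule rev_mp)
  moreover have "n A \<beta> - n B \<beta> = 0" if "\<beta> \<notin> h ` L"
  proof -
    have "{c \<in> A. h c = \<beta>} = {}" "{c \<in> B. h c = \<beta>} = {}"
      using that AB by auto
    then show ?thesis
      by (simp only: n_def card.empty)
  qed
  ultimately show ?thesis
    by (cases "\<beta> \<in> h ` L") (auto simp: n_def)
qed

text \<open>Used to find a tile of prescribed width above a level line and a tile of prescribed
  height in a column.\<close>

lemma ex_same_of_sum_eq:
  fixes h :: "'l \<Rightarrow> real"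
  assumes L: "finite L" "Q_lin_indep (h ` L)" and AB: "A \<subseteq> L" "B \<subseteq> L"
    and eq: "sum h A = sum h B" and "a \<in> A"
  shows "\<exists>b\<in>B. h b = h a"
proof -
  have "finite {c \<in> A. h c = h a}"
    using L(1) AB(1) by (simp add: finite_subset)
  then have "0 < card {c \<in> A. h c = h a}"
    using \<open>a \<in> A\<close> by (auto simp: card_gt_0_iff)
  then have "{c \<in> B. h c = h a} \<noteq> {}"
    using card_eq_of_sum_eq[OF L AB eq] by (metis card_gt_0_iff)
  then show ?thesis
    by blast
qed

lemma ex_max_on:
  fixes g :: "'a \<Rightarrow> 'b::linorder"
  assumes "finite S" "S \<noteq> {}"
  shows "\<exists>c\<in>S. \<forall>d\<in>S. g d \<le> g c"
proof -

  have "Max (g ` S) \<in> g ` S"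
    using assms by (intro Max_in) auto
  then obtain c where "c \<in> S" "g c = Max (g ` S)"
    by (metis imageE)
  then show ?thesis
    using assms(1) by (intro bexI[of _ c]) auto
qed

section \<open>Tilings of an interval by half-open intervals\<close>

definition ind :: "real \<Rightarrow> real \<Rightarrow> real \<Rightarrow> real" where
  "ind p q t = of_bool (p \<le> t \<and> t < q)"

text \<open>With half-open intervals the identity of indicators holds at every point, end points
  included, so cutting off a tile or joining pieces is mere addition.\<close>

definition line_tiling :: "'l set \<Rightarrow> ('l \<Rightarrow> real) \<Rightarrow> ('l \<Rightarrow> real) \<Rightarrow> real \<Rightarrow> real \<Rightarrow> bool" where
  "line_tiling L w x p q \<longleftrightarrow> (\<forall>t. (\<Sum>c\<in>L. ind (x c) (x c + w c) t) = ind p q t)"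

lemma sum_of_bool_eq_0:
  assumes "finite L" "(\<Sum>c\<in>L. of_bool (g c) :: real) = 0" "c \<in> L"
  shows "\<not> g c"
  using assms by (auto simp: sum_nonneg_eq_0_iff)

lemma sum_of_bool_eq_1:
  assumes "finite L" "(\<Sum>c\<in>L. of_bool (g c) :: real) = 1"
  shows "\<exists>!c. c \<in> L \<and> g c"
proof -
  have "card {c \<in> L. g c} = 1"
    using assms by (simp add: Int_def)
  then obtain c where "{c \<in> L. g c} = {c}"
    using card_1_singletonE by blast
  then show ?thesis
    by (metis (mono_tags, lifting) mem_Collect_eq singletonD singletonI)
qed

lemma sum_of_bool_ex1:
  assumes "finite L" "\<exists>!c. c \<in> L \<and> g c"
  shows "(\<Sum>c\<in>L. of_bool (g c) :: real) = 1"
proof -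
  obtain c where "{c \<in> L. g c} = {c}"
    using assms(2) by auto
  then show ?thesis
    using assms(1) by (simp add: Int_def)
qed

lemma sum_of_bool_none:
  assumes "\<And>c. c \<in> L \<Longrightarrow> \<not> g c"
  shows "(\<Sum>c\<in>L. of_bool (g c) :: real) = 0"
  using assms by (simp add: sum.neutral)

context
  fixes L :: "'l set" and w x :: "'l \<Rightarrow> real" and p q :: real
  assumes L: "finite L" "\<And>c. c \<in> L \<Longrightarrow> w c > 0" and tile: "line_tiling L w x p q"
begin

lemma line_sum: "(\<Sum>c\<in>L. of_bool (x c \<le> t \<and> t < x c + w c) :: real) = of_bool (p \<le> t \<and> t < q)"
  using tile by (simp add: line_tiling_def ind_def)

lemma line_tiling_cover:
  assumes "p \<le> t" "t < q"
  shows "\<exists>c\<in>L. x c \<le> t \<and> t < x c + w c"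
  using sum_of_bool_eq_1[OF L(1), of "\<lambda>c. x c \<le> t \<and> t < x c + w c"] line_sum[of t] assms by auto

lemma line_tiling_range:
  assumes "c \<in> L" "x c \<le> t" "t < x c + w c"
  shows "p \<le> t" "t < q"
  using sum_of_bool_eq_0[OF L(1), of "\<lambda>c. x c \<le> t \<and> t < x c + w c" c] line_sum[of t] assms
  by (cases "p \<le> t \<and> t < q"; simp)+

lemma line_tiling_unique:
  assumes "c \<in> L" "x c \<le> t" "t < x c + w c" "d \<in> L" "x d \<le> t" "t < x d + w d"
  shows "c = d"
  using sum_of_bool_eq_1[OF L(1), of "\<lambda>c. x c \<le> t \<and> t < x c + w c"] line_sum[of t]
    line_tiling_range[of c t] assms by auto

lemma line_tiling_bounds:
  assumes "c \<in> L"
  shows "p \<le> x c" "x c + w c \<le> q" "x c < q"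
proof -
  show "p \<le> x c" "x c < q"
    using line_tiling_range[of c "x c"] L(2) assms by auto
  show "x c + w c \<le> q"
    \<comment> \<open>If \<open>c\<close> ended beyond \<open>q\<close>, it would contain this
      point, which is at least \<open>q\<close>.\<close>
    using line_tiling_range[of c "max (x c) q"] L(2)[of c] assms by linarith
qed

lemma line_tiling_inj: "c \<in> L \<Longrightarrow> d \<in> L \<Longrightarrow> x c = x d \<Longrightarrow> c = d"
  using line_tiling_unique[of c "x c" d] L(2) by auto

text \<open>Integrating the identity of indicators over the real line compares total lengths. For
  \<open>q < p\<close> the indicator \<open>ind p q\<close> vanishes, so \<open>p \<le> q\<close> is
  what makes \<open>q - p\<close> its integral.\<close>

lemma line_tiling_sum:
  assumes "p \<le> q"
  shows "sum w L = q - p"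
proof -
  have one: "(ind a b has_integral (b - a)) UNIV" if "a \<le> b" for a b
  proof -
    \<comment> \<open>The integral is known for the closed interval; the end point \<open>b\<close>
      is then dropped as a null set.\<close>
    have "((\<lambda>_. 1::real) has_integral (b - a)) {a..b}"
      using has_integral_const_real[of "1::real" a b] that by (metis content_real mult.right_neutral real_scaleR_def)
    then have "((\<lambda>t. if t \<in> {a..b} then 1 else 0::real) has_integral (b - a)) UNIV"
      by (simp only: has_integral_restrict_UNIV)
    then show ?thesis
      by (rule has_integral_spike_finite[of "{b}", rotated 2]) (auto simp: ind_def)
  qed
  have "((\<lambda>t. \<Sum>c\<in>L. ind (x c) (x c + w c) t) has_integral (\<Sum>c\<in>L. x c + w c - x c)) UNIV"
    using L by (intro has_integral_sum one) (auto simp: less_imp_le)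
  then have "(ind p q has_integral sum w L) UNIV"
    using tile by (simp add: line_tiling_def)
  then show ?thesis
    using one[OF assms] has_integral_unique by blast
qed

text \<open>Among the tiles starting before \<open>b\<close>, the one starting last ends where
  \<open>b\<close> starts: ending later it would overlap \<open>b\<close>, and ending earlier it
  would leave a point whose tile starts even later.\<close>

lemma line_tiling_pred:
  assumes "b \<in> L" "p < x b"
  shows "\<exists>c\<in>L. x c + w c = x b"
proof -
  let ?S = "{c \<in> L. x c < x b}"
  obtain c0 where "c0 \<in> L" "x c0 \<le> p"
    using line_tiling_cover[of p] line_tiling_bounds[OF assms(1)] assms by auto
  then have "?S \<noteq> {}" "finite ?S"
    using assms L(1) by auto
  then obtain c where c: "c \<in> ?S" and cmax: "\<And>d. d \<in> ?S \<Longrightarrow> x d \<le> x c"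
    using ex_max_on[of ?S x] by blast
  have le: "x c + w c \<le> x b"
    using line_tiling_unique[of c "x b" b] c assms L(2)[of b] by force
  moreover have False if "x c + w c < x b"
  proof -
    have "p \<le> x c + w c" "x c + w c < q"
      using line_tiling_bounds[of c] line_tiling_bounds[OF assms(1)] c L(2)[of c] that by auto
    then obtain d where d: "d \<in> L" "x d \<le> x c + w c" "x c + w c < x d + w d"
      using line_tiling_cover by blast
    then have "x d \<le> x c"
      using cmax that by auto
    then show False
      using line_tiling_unique[of c "x c" d] c d L(2)[of c] by auto
  qed
  ultimately show ?thesis
    using c by force
qed

lemma line_tiling_succ:
  assumes "b \<in> L" "x b + w b < q"
  shows "\<exists>c\<in>L. x c = x b + w b"
proof -
  obtain c where c: "c \<in> L" "x c \<le> x b + w b" "x b + w b < x c + w c"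
    using line_tiling_cover[of "x b + w b"] line_tiling_bounds[OF assms(1)] assms L(2)[of b] by force
  \<comment> \<open>If \<open>c\<close> started before the end of \<open>b\<close>, both tiles would
    contain the later of their two starting points.\<close>
  then have "x c = x b + w b"
    using line_tiling_unique[of c "max (x b) (x c)" b] L(2)[of b] L(2)[of c] assms(1) by force
  then show ?thesis
    using c by blast
qed

text \<open>No tile straddles \<open>x c\<close>, since it would meet \<open>c\<close>
  there.\<close>

lemma line_tiling_below:
  assumes "c \<in> L"
  shows "line_tiling {d \<in> L. x d < x c} w x p (x c)"
  unfolding line_tiling_def
proof
  fix t
  have q: "x c < q"
    using line_tiling_bounds[OF assms] by simp
  show "(\<Sum>d\<in>{d \<in> L. x d < x c}. ind (x d) (x d + w d) t) = ind p (x c) t"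
  proof (cases "t < x c")
    case True
    then have "(\<Sum>d\<in>{d \<in> L. x d < x c}. ind (x d) (x d + w d) t) = (\<Sum>d\<in>L. ind (x d) (x d + w d) t)"
      using L(1) by (intro sum.mono_neutral_left) (auto simp: ind_def)
    then show ?thesis
      using tile True q by (simp add: line_tiling_def ind_def)
  next
    case False
    then have "\<not> (x d \<le> t \<and> t < x d + w d)" if "d \<in> L" "x d < x c" for d
      using line_tiling_unique[of d "x c" c] that assms L(2)[of c] by auto
    then show ?thesis
      using False by (auto simp: ind_def intro!: sum.neutral)
  qed
qed

end

text \<open>Turns positions into sums of lengths, the form to which independence applies.\<close>

lemma line_tiling_sum_below:
  fixes L :: "'l set" and w x :: "'l \<Rightarrow> real"
  assumes L: "finite L" "\<And>c. c \<in> L \<Longrightarrow> w c > 0" and tile: "line_tiling L w x p q" and "c \<in> L"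
  shows "sum w {d \<in> L. x d < x c} = x c - p"
  using line_tiling_below[OF assms] line_tiling_bounds[OF assms] L
  by (intro line_tiling_sum[where x = x]) auto

section \<open>Tilings of a rectangle and shuffles of adjacent tiles\<close>

text \<open>The tiles are indexed by \<open>L\<close> and have fixed widths \<open>w\<close> and heights \<open>h\<close>; a placement \<open>s\<close> gives their
  lower left corners.  Summing indicator functions expresses covering and disjointness at once.\<close>

definition tiling ::
    "'l set \<Rightarrow> ('l \<Rightarrow> real) \<Rightarrow> ('l \<Rightarrow> real) \<Rightarrow> ('l \<Rightarrow> real \<times> real) \<Rightarrow> real \<Rightarrow> real \<Rightarrow> real \<Rightarrow> real \<Rightarrow> bool"
  where "tiling L w h s X0 X1 Y0 Y1 \<longleftrightarrow>
    (\<forall>u v. (\<Sum>c\<in>L. ind (fst (s c)) (fst (s c) + w c) u * ind (snd (s c)) (snd (s c) + h c) v)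
      = ind X0 X1 u * ind Y0 Y1 v)"

definition hstep ::
    "'l set \<Rightarrow> ('l \<Rightarrow> real) \<Rightarrow> ('l \<Rightarrow> real) \<Rightarrow> ('l \<Rightarrow> real \<times> real) \<Rightarrow> ('l \<Rightarrow> real \<times> real) \<Rightarrow> bool"
  where "hstep L w h s s' \<longleftrightarrow> (\<exists>a\<in>L. \<exists>b\<in>L. a \<noteq> b \<and> snd (s a) = snd (s b) \<and> h a = h b
    \<and> fst (s b) = fst (s a) + w a \<and> s' = s(a := (fst (s a) + w b, snd (s a)), b := s a))"

text \<open>A vertical shuffle is a horizontal one seen after reflection in the diagonal, which also
  exchanges \<open>w\<close> and \<open>h\<close>; facts about rows thus serve for columns.\<close>

definition step ::
    "'l set \<Rightarrow> ('l \<Rightarrow> real) \<Rightarrow> ('l \<Rightarrow> real) \<Rightarrow> ('l \<Rightarrow> real \<times> real) \<Rightarrow> ('l \<Rightarrow> real \<times> real) \<Rightarrow> bool"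
  where "step L w h s s' \<longleftrightarrow> hstep L w h s s' \<or> hstep L h w (prod.swap \<circ> s) (prod.swap \<circ> s')"

abbreviation moves ::
    "'l set \<Rightarrow> ('l \<Rightarrow> real) \<Rightarrow> ('l \<Rightarrow> real) \<Rightarrow> ('l \<Rightarrow> real \<times> real) \<Rightarrow> ('l \<Rightarrow> real \<times> real) \<Rightarrow> bool"
  where "moves L w h \<equiv> (step L w h)\<^sup>*\<^sup>*"

section \<open>Symmetries of the move relation\<close>

lemma swap_swap_comp [simp]: "prod.swap \<circ> (prod.swap \<circ> s) = s"
  by (simp add: fun_eq_iff)

text \<open>The same pair, taken in its new order, shuffles back.\<close>

lemma hstep_sym:
  assumes "hstep L w h s s'"
  shows "hstep L w h s' s"
proof -
  obtain a b where ab: "a \<in> L" "b \<in> L" "a \<noteq> b" "snd (s a) = snd (s b)" "h a = h b"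
      "fst (s b) = fst (s a) + w a"
    and s': "s' = s(a := (fst (s a) + w b, snd (s a)), b := s a)"
    using assms unfolding hstep_def by blast
  have sb: "s b = (fst (s a) + w a, snd (s a))"
    using ab by (simp add: prod_eq_iff)
  show ?thesis
    unfolding hstep_def
    by (rule bexI[OF _ ab(2)], rule bexI[OF _ ab(1)]) (use ab sb s' in \<open>auto simp: fun_eq_iff\<close>)
qed

lemma step_transpose: "step L w h s s' \<Longrightarrow> step L h w (prod.swap \<circ> s) (prod.swap \<circ> s')"
  by (auto simp: step_def)

lemma moves_transpose: "moves L w h s s' \<Longrightarrow> moves L h w (prod.swap \<circ> s) (prod.swap \<circ> s')"
proof (induction rule: rtranclp_induct)
  case (step y z)
  then show ?case
    using step_transpose rtranclp.rtrancl_into_rtrancl by metis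
qed simp

lemma moves_sym: "moves L w h s s' \<Longrightarrow> moves L w h s' s"
proof (rule sympD[OF symp_rtranclp])
  show "symp (step L w h)"
    by (auto simp: step_def symp_def dest: hstep_sym)
qed

lemma moves_mono:
  assumes "K \<subseteq> L" "moves K w h s s'"
  shows "moves L w h s s'"
proof -
  have "step L w h s s'" if "step K w h s s'" for s s'
    using that assms(1) unfolding step_def hstep_def by blast
  then show ?thesis
    using assms(2) by (metis mono_rtranclp)
qed

text \<open>Placements are total functions; this is what keeps all other tiles in place when moves
  of a subset are read as moves of the whole tiling.\<close>

lemma moves_outside:
  assumes "moves L w h s s'" "c \<notin> L"
  shows "s' c = s c"
proof -
  have hstep: "s' c = s c" if "hstep L w h s s'" for w h s s'
    using that assms(2) unfolding hstep_def by auto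
  have step: "s' c = s c" if "step L w h s s'" for s s'
  proof -
    have "prod.swap (s' c) = prod.swap (s c)" if "hstep L h w (prod.swap \<circ> s) (prod.swap \<circ> s')"
      using hstep[OF that] by simp
    then show ?thesis
      using that hstep unfolding step_def by (metis swap_swap)
  qed
  show ?thesis
    using assms(1) by (induction rule: rtranclp_induct) (auto dest: step)
qed

text \<open>A move depends only on positions and sizes, so a size-preserving relabelling carries it
  over. Involutions suffice, as only transpositions of two labels are applied later.\<close>

lemma moves_relabel:
  assumes "moves L w h s s'"
    and inv: "\<And>c. \<pi> (\<pi> c) = c" "\<And>c. c \<in> L \<Longrightarrow> \<pi> c \<in> L"
    and same: "\<And>c. w (\<pi> c) = w c" "\<And>c. h (\<pi> c) = h c"
  shows "moves L w h (s \<circ> \<pi>) (s' \<circ> \<pi>)"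
proof -
  have hstep: "hstep L w h (s \<circ> \<pi>) (s' \<circ> \<pi>)"
    if hs: "hstep L w h s s'" and same: "\<And>c. w (\<pi> c) = w c" "\<And>c. h (\<pi> c) = h c"
    for w h :: "'a \<Rightarrow> real" and s s'
  proof -
    obtain a b where ab: "a \<in> L" "b \<in> L" "a \<noteq> b" "snd (s a) = snd (s b)" "h a = h b"
        "fst (s b) = fst (s a) + w a"
      and s': "s' = s(a := (fst (s a) + w b, snd (s a)), b := s a)"
      using hs unfolding hstep_def by blast
    have "\<pi> c = d \<longleftrightarrow> c = \<pi> d" for c d
      using inv(1) by metis
    then have "s' \<circ> \<pi> = (s \<circ> \<pi>)(\<pi> a := (fst ((s \<circ> \<pi>) (\<pi> a)) + w (\<pi> b), snd ((s \<circ> \<pi>) (\<pi> a))),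
        \<pi> b := (s \<circ> \<pi>) (\<pi> a))"
      by (auto simp: s' fun_eq_iff inv same)
    moreover have "\<pi> a \<noteq> \<pi> b"
      using ab inv(1) by metis
    moreover have "\<pi> a \<in> L" "\<pi> b \<in> L"
      using ab inv by auto
    ultimately show ?thesis
      unfolding hstep_def using ab(4-6)
      by (intro bexI[of _ "\<pi> a"] bexI[of _ "\<pi> b"]) (simp_all add: inv same)
  qed
  have "step L w h (s \<circ> \<pi>) (s' \<circ> \<pi>)" if "step L w h s s'" for s s'
    using that hstep[of w h s s'] hstep[of h w "prod.swap \<circ> s" "prod.swap \<circ> s'"] same
    by (auto simp: step_def comp_assoc)
  show ?thesis
    using assms(1)
  proof (induction rule: rtranclp_induct)
    case (step y z)
    then show ?case
      using \<open>\<And>s s'. step L w h s s' \<Longrightarrow> step L w h (s \<circ> \<pi>) (s' \<circ> \<pi>)\<close> rtranclp.rtrancl_into_rtrancl by metis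
  qed simp
qed

section \<open>Invariance of tilings\<close>

lemma tiling_transpose:
  "tiling L w h s X0 X1 Y0 Y1 \<Longrightarrow> tiling L h w (prod.swap \<circ> s) Y0 Y1 X0 X1"
  by (auto simp: tiling_def mult.commute)

lemma tiling_transpose_iff:
  "tiling L h w (prod.swap \<circ> s) Y0 Y1 X0 X1 \<longleftrightarrow> tiling L w h s X0 X1 Y0 Y1"
  using tiling_transpose[of L w h s] tiling_transpose[of L h w "prod.swap \<circ> s"] by auto

lemma tiling_hstep:
  assumes "finite L" "\<And>c. c \<in> L \<Longrightarrow> w c > 0" "tiling L w h s X0 X1 Y0 Y1" "hstep L w h s s'"
  shows "tiling L w h s' X0 X1 Y0 Y1"
proof -
  obtain a b where ab: "a \<in> L" "b \<in> L" "a \<noteq> b" "snd (s a) = snd (s b)" "h a = h b"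
      "fst (s b) = fst (s a) + w a"
    and s': "s' = s(a := (fst (s a) + w b, snd (s a)), b := s a)"
    using assms(4) unfolding hstep_def by blast
  define g where "g s c u v = ind (fst (s c)) (fst (s c) + w c) u * ind (snd (s c)) (snd (s c) + h c) v"
    for s :: "'a \<Rightarrow> real \<times> real" and c u v
  have split: "(\<Sum>c\<in>L. g t c u v) = g t a u v + g t b u v + (\<Sum>c\<in>L - {a, b}. g t c u v)" for t u v
  proof -
    have "(\<Sum>c\<in>L. g t c u v) = g t a u v + (\<Sum>c\<in>L - {a}. g t c u v)"
      using assms(1) ab by (simp add: sum.remove)
    also have "(\<Sum>c\<in>L - {a}. g t c u v) = g t b u v + (\<Sum>c\<in>L - {a} - {b}. g t c u v)"
      using assms(1) ab by (intro sum.remove) auto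
    also have "L - {a} - {b} = L - {a, b}"
      by auto
    finally show ?thesis
      by simp
  qed
  have "w a > 0" "w b > 0"
    using assms(2) ab by auto
  \<comment> \<open>Before and after the shuffle the two tiles fill the same box, as they share
    height and bottom edge.\<close>
  then have "g s' a u v + g s' b u v = g s a u v + g s b u v" for u v
    using ab(3-6) by (auto simp: g_def s' ind_def)
  moreover have "(\<Sum>c\<in>L - {a, b}. g s' c u v) = (\<Sum>c\<in>L - {a, b}. g s c u v)" for u v
    by (intro sum.cong) (auto simp: g_def s')
  ultimately have "(\<Sum>c\<in>L. g s' c u v) = (\<Sum>c\<in>L. g s c u v)" for u v
    by (simp add: split)
  then show ?thesis
    using assms(3) by (simp add: tiling_def g_def)
qed

lemma tiling_moves:
  assumes "moves L w h s s'" "tiling L w h s X0 X1 Y0 Y1"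
    and L: "finite L" "\<And>c. c \<in> L \<Longrightarrow> w c > 0" "\<And>c. c \<in> L \<Longrightarrow> h c > 0"
  shows "tiling L w h s' X0 X1 Y0 Y1"
proof -
  have step: "tiling L w h s' X0 X1 Y0 Y1" if "step L w h s s'" "tiling L w h s X0 X1 Y0 Y1" for s s'
    using that(1) unfolding step_def
  proof
    assume "hstep L w h s s'"
    then show ?thesis
      using tiling_hstep L that(2) by blast
  next
    assume "hstep L h w (prod.swap \<circ> s) (prod.swap \<circ> s')"
    then have "tiling L h w (prod.swap \<circ> s') Y0 Y1 X0 X1"
      using tiling_hstep L tiling_transpose[OF that(2)] by blast
    then show ?thesis
      by (simp add: tiling_transpose_iff)
  qed
  show ?thesis
    using assms(1,2) by (induction rule: rtranclp_induct) (auto dest: step)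
qed

lemma tiling_relabel:
  assumes "tiling L w h s X0 X1 Y0 Y1" and inv: "\<And>c. \<pi> (\<pi> c) = c"
    and same: "\<And>c. w (\<pi> c) = w c" "\<And>c. h (\<pi> c) = h c"
  shows "tiling (\<pi> ` L) w h (s \<circ> \<pi>) X0 X1 Y0 Y1"
  unfolding tiling_def
proof (intro allI)
  fix u v
  have "(\<Sum>c\<in>\<pi> ` L. ind (fst ((s \<circ> \<pi>) c)) (fst ((s \<circ> \<pi>) c) + w c) u
        * ind (snd ((s \<circ> \<pi>) c)) (snd ((s \<circ> \<pi>) c) + h c) v)
    = (\<Sum>c\<in>L. ind (fst (s c)) (fst (s c) + w c) u * ind (snd (s c)) (snd (s c) + h c) v)"
    by (rule sum.reindex_bij_witness[where i = \<pi> and j = \<pi>]) (auto simp: inv same)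
  then show "(\<Sum>c\<in>\<pi> ` L. ind (fst ((s \<circ> \<pi>) c)) (fst ((s \<circ> \<pi>) c) + w c) u
        * ind (snd ((s \<circ> \<pi>) c)) (snd ((s \<circ> \<pi>) c) + h c) v) = ind X0 X1 u * ind Y0 Y1 v"
    using assms(1) by (simp add: tiling_def)
qed

lemma line_tiling_relabel:
  assumes "line_tiling L w x p q" and inv: "\<And>c. \<pi> (\<pi> c) = c" and same: "\<And>c. w (\<pi> c) = w c"
  shows "line_tiling (\<pi> ` L) w (\<lambda>c. x (\<pi> c)) p q"
  unfolding line_tiling_def
proof
  fix u
  have "(\<Sum>c\<in>\<pi> ` L. ind (x (\<pi> c)) (x (\<pi> c) + w c) u) = (\<Sum>c\<in>L. ind (x c) (x c + w c) u)"
    by (rule sum.reindex_bij_witness[where i = \<pi> and j = \<pi>]) (auto simp: inv same)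
  then show "(\<Sum>c\<in>\<pi> ` L. ind (x (\<pi> c)) (x (\<pi> c) + w c) u) = ind p q u"
    using assms(1) by (simp add: line_tiling_def)
qed

text \<open>Fixing the first coordinate makes the horizontal factor of each term 0 or 1, which
  selects the tiles met by the vertical line at \<open>u\<close>.\<close>

lemma tiling_slice:
  assumes "finite L" "tiling L w h s X0 X1 Y0 Y1" "X0 \<le> u" "u < X1"
  shows "line_tiling {c \<in> L. fst (s c) \<le> u \<and> u < fst (s c) + w c} h (\<lambda>c. snd (s c)) Y0 Y1"
  unfolding line_tiling_def
proof
  fix v
  have "(\<Sum>c\<in>{c \<in> L. fst (s c) \<le> u \<and> u < fst (s c) + w c}. ind (snd (s c)) (snd (s c) + h c) v)
    = (\<Sum>c\<in>L. ind (fst (s c)) (fst (s c) + w c) u * ind (snd (s c)) (snd (s c) + h c) v)"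
    unfolding sum.inter_filter[OF assms(1)] by (rule sum.cong) (simp_all add: ind_def)
  also have "\<dots> = ind Y0 Y1 v"
    using assms by (simp add: tiling_def ind_def)
  finally show "(\<Sum>c\<in>{c \<in> L. fst (s c) \<le> u \<and> u < fst (s c) + w c}. ind (snd (s c)) (snd (s c) + h c) v)
    = ind Y0 Y1 v" .
qed

section \<open>Rows of equal height\<close>

text \<open>Tile \<open>b\<close> is exchanged with its left neighbour until it is leftmost; the
  number of tiles to its left is the induction measure.\<close>

lemma row_bubble:
  assumes "finite R" "\<And>c. c \<in> R \<Longrightarrow> w c > 0" "\<And>c. c \<in> R \<Longrightarrow> h c = \<beta>"
    and "\<And>c. c \<in> R \<Longrightarrow> snd (s c) = y" "line_tiling R w (\<lambda>c. fst (s c)) p q" "b \<in> R"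
  shows "\<exists>s'. moves R w h s s' \<and> (\<forall>c\<in>R. snd (s' c) = y) \<and> line_tiling R w (\<lambda>c. fst (s' c)) p q
    \<and> fst (s' b) = p"
  using assms(4,5)
proof (induction "card {c \<in> R. fst (s c) < fst (s b)}" arbitrary: s rule: less_induct)
  case less
  note tile = less.prems(2)
  have p: "p \<le> fst (s b)"
    using line_tiling_bounds(1)[OF assms(1,2) tile assms(6)] .
  show ?case
  proof (cases "fst (s b) = p")
    case True
    then show ?thesis
      using less.prems by blast
  next
    case False
    then obtain a where a: "a \<in> R" "fst (s a) + w a = fst (s b)"
      using line_tiling_pred[OF assms(1,2) tile assms(6)] p by force
    have ab: "a \<noteq> b" "w a > 0" "w b > 0"
      using a assms(2,6) by force+
    define t where "t = s(a := (fst (s a) + w b, snd (s a)), b := s a)"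
    have "hstep R w h s t"
      unfolding hstep_def t_def using a ab assms(3,6) less.prems(1)
      by (intro bexI[of _ a] bexI[of _ b]) auto
    then have st: "moves R w h s t"
      by (simp add: step_def r_into_rtranclp)
    have t_y: "snd (t c) = y" if "c \<in> R" for c
      using that less.prems(1) a(1) by (auto simp: t_def)
    have t_tile: "line_tiling R w (\<lambda>c. fst (t c)) p q"
      unfolding line_tiling_def
    proof
      fix u
      have split: "(\<Sum>c\<in>R. ind (fst (r c)) (fst (r c) + w c) u) = ind (fst (r a)) (fst (r a) + w a) u
          + ind (fst (r b)) (fst (r b) + w b) u + (\<Sum>c\<in>R - {a} - {b}. ind (fst (r c)) (fst (r c) + w c) u)"
        for r
        using a(1) ab(1) assms(1,6) by (simp add: sum.remove[of R a] sum.remove[of "R - {a}" b])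
      have "ind (fst (t a)) (fst (t a) + w a) u + ind (fst (t b)) (fst (t b) + w b) u
        = ind (fst (s a)) (fst (s a) + w a) u + ind (fst (s b)) (fst (s b) + w b) u"
        using a(2) ab by (auto simp: t_def ind_def)
      moreover have "(\<Sum>c\<in>R - {a} - {b}. ind (fst (t c)) (fst (t c) + w c) u)
          = (\<Sum>c\<in>R - {a} - {b}. ind (fst (s c)) (fst (s c) + w c) u)"
        by (intro sum.cong) (auto simp: t_def)
      ultimately show "(\<Sum>c\<in>R. ind (fst (t c)) (fst (t c) + w c) u) = ind p q u"
        using tile split[of s] split[of t] by (simp add: line_tiling_def)
    qed
    \<comment> \<open>The exchange puts \<open>a\<close> to the right of \<open>b\<close>, moves
      \<open>b\<close> to the left and leaves the rest in place.\<close>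
    have "{c \<in> R. fst (t c) < fst (t b)} \<subset> {c \<in> R. fst (s c) < fst (s b)}"
    proof
      show "{c \<in> R. fst (t c) < fst (t b)} \<subseteq> {c \<in> R. fst (s c) < fst (s b)}"
        using a(2) ab by (auto simp: t_def split: if_splits)
      have "a \<in> {c \<in> R. fst (s c) < fst (s b)}" "a \<notin> {c \<in> R. fst (t c) < fst (t b)}"
        using a ab by (auto simp: t_def)
      then show "{c \<in> R. fst (t c) < fst (t b)} \<noteq> {c \<in> R. fst (s c) < fst (s b)}"
        by blast
    qed
    then have "card {c \<in> R. fst (t c) < fst (t b)} < card {c \<in> R. fst (s c) < fst (s b)}"
      using assms(1) by (intro psubset_card_mono) auto
    then obtain s' where "moves R w h t s'" "\<forall>c\<in>R. snd (s' c) = y"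
        "line_tiling R w (\<lambda>c. fst (s' c)) p q" "fst (s' b) = p"
      using less.hyps[of t] t_y t_tile by blast
    then show ?thesis
      using st rtranclp_trans[of "step R w h" s t s'] by blast
  qed
qed

text \<open>The tile that comes first in the target is brought to the front, and the remaining row
  is treated by induction. Reflected in the diagonal, this serves for columns.\<close>

lemma row_connected:
  assumes "finite R" "\<And>c. c \<in> R \<Longrightarrow> w c > 0" "\<And>c. c \<in> R \<Longrightarrow> h c = \<beta>"
    and "\<And>c. c \<in> R \<Longrightarrow> snd (s c) = y" "\<And>c. c \<in> R \<Longrightarrow> snd (s' c) = y"
    and "line_tiling R w (\<lambda>c. fst (s c)) p q" "line_tiling R w (\<lambda>c. fst (s' c)) p q"
    and "\<And>c. c \<notin> R \<Longrightarrow> s c = s' c"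
  shows "moves R w h s s'"
  using assms
proof (induction "card R" arbitrary: R s p rule: less_induct)
  case less
  note R = less.prems(1,2)
  show ?case
  proof (cases "R = {}")
    case True
    then have "s = s'"
      using less.prems(8) by auto
    then show ?thesis
      by simp
  next
    case False
    then obtain d where "d \<in> R"
      by blast
    then have "p \<le> p" "p < q"
      using line_tiling_bounds[OF R less.prems(7)] by force+
    then obtain b where b: "b \<in> R" "fst (s' b) \<le> p"
      using line_tiling_cover[OF R less.prems(7)] by blast
    then have b_p: "fst (s' b) = p"
      using line_tiling_bounds(1)[OF R less.prems(7)] by force
    obtain t where t: "moves R w h s t" "\<forall>c\<in>R. snd (t c) = y"
        "line_tiling R w (\<lambda>c. fst (t c)) p q" "fst (t b) = p"
      using row_bubble[where h = h and \<beta> = \<beta>, OF less.prems(1-4,6) b(1)] by blast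
    have rest: "line_tiling (R - {b}) w (\<lambda>c. fst (r c)) (p + w b) q"
      if r: "line_tiling R w (\<lambda>c. fst (r c)) p q" "fst (r b) = p" for r
      unfolding line_tiling_def
    proof
      fix u
      have "p + w b \<le> q" "w b > 0"
        using line_tiling_bounds(2)[OF R r(1) b(1)] r(2) less.prems(2) b(1) by auto
      moreover have "ind p (p + w b) u + (\<Sum>c\<in>R - {b}. ind (fst (r c)) (fst (r c) + w c) u) = ind p q u"
        using r b(1) less.prems(1) sum.remove[of R b "\<lambda>c. ind (fst (r c)) (fst (r c) + w c) u"]
        by (simp add: line_tiling_def)
      ultimately show "(\<Sum>c\<in>R - {b}. ind (fst (r c)) (fst (r c) + w c) u) = ind (p + w b) q u"
        by (auto simp: ind_def split: if_splits)
    qed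
    have "card (R - {b}) < card R"
      using b(1) less.prems(1) by (intro psubset_card_mono) auto
    moreover have "t c = s' c" if "c \<notin> R - {b}" for c
    proof (cases "c = b")
      case True
      then show ?thesis
        using t b b_p less.prems(5) by (simp add: prod_eq_iff)
    next
      case False
      then show ?thesis
        using that moves_outside[OF t(1)] less.prems(8) by auto
    qed
    ultimately have "moves (R - {b}) w h t s'"
      using t rest[OF t(3,4)] rest[OF less.prems(7) b_p] less.prems(1-5)
      by (intro less.hyps) auto
    then have "moves R w h t s'"
      by (rule moves_mono[rotated]) auto
    then show ?thesis
      using t(1) by (rule rtranclp_trans[rotated])
  qed
qed

section \<open>Components of a finite union of intervals\<close>

text \<open>The first gap after \<open>p\<close> starts at the right end of some interval, so
  \<open>q\<close> is taken as the least right end beyond \<open>p\<close> that is outside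
  \<open>E\<close>.\<close>

lemma component_end:
  fixes x w :: "'l \<Rightarrow> real"
  assumes "finite U" "\<And>c. c \<in> U \<Longrightarrow> w c > 0"
    and e: "\<And>u. E u \<longleftrightarrow> (\<exists>c\<in>U. x c \<le> u \<and> u < x c + w c)" and "E p"
  shows "\<exists>q>p. \<not> E q \<and> (\<forall>u. p \<le> u \<and> u < q \<longrightarrow> E u)"
proof -
  let ?ends = "(\<lambda>c. x c + w c) ` U"
  let ?S = "{r \<in> ?ends. p < r \<and> \<not> E r}"
  have end_after: "\<exists>r\<in>?ends. u < r" if "E u" for u
    using that e by auto
  have fin: "finite ?ends"
    using assms(1) by simp
  obtain r where "r \<in> ?ends" "p < r"
    using end_after[OF \<open>E p\<close>] by blast
  then have ne: "?ends \<noteq> {}" "p < Max ?ends"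
    using Max_ge[OF fin, of r] by auto
  have "\<not> E (Max ?ends)"
    using end_after[of "Max ?ends"] fin by (meson Max_ge leD)
  then have "Max ?ends \<in> ?S"
    using ne fin Max_in by auto
  then have S: "?S \<noteq> {}" "finite ?S"
    using fin by auto
  define q where "q = Min ?S"
  have q: "q \<in> ?S"
    unfolding q_def using S by (rule Min_in[rotated])
  have "E u" if u: "p \<le> u" "u < q" for u
  proof (rule ccontr)
    assume nE: "\<not> E u"
    let ?T = "{r \<in> ?ends. p < r \<and> r \<le> u}"
    obtain c where c: "c \<in> U" "x c \<le> p" "p < x c + w c"
      using e \<open>E p\<close> by blast
    then have "x c + w c \<in> ?T"
      using nE e[of u] u by force
    then have T: "?T \<noteq> {}" "finite ?T"
      using fin by auto
    \<comment> \<open>The last right end up to the supposed gap \<open>u\<close>. It lies in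
      \<open>E\<close> by minimality of \<open>q\<close>, but an interval covering it would end
      later and still not beyond \<open>u\<close>.\<close>
    define r where "r = Max ?T"
    have r: "r \<in> ?T"
      unfolding r_def using T by (rule Max_in[rotated])
    have "E r"
    proof (rule ccontr)
      assume "\<not> E r"
      then have "r \<in> ?S"
        using r by auto
      then have "q \<le> r"
        unfolding q_def using S(2) by (rule Min_le[rotated])
      then show False
        using r u by auto
    qed
    then obtain d where d: "d \<in> U" "x d \<le> r" "r < x d + w d"
      using e by blast
    then have "x d + w d \<in> ?T"
      using nE e[of u] r by force
    then have "x d + w d \<le> r"
      unfolding r_def using T(2) by (rule Max_ge[rotated])
    then show False
      using d by simp
  qed
  then show ?thesis
    using q by auto
qed

text \<open>No interval straddles \<open>q\<close>, as \<open>q\<close> is outside \<open>E\<close>;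
  those starting before \<open>q\<close> therefore fill exactly the component that begins at
  \<open>p\<close>.\<close>

lemma component_line_tiling:
  fixes x w :: "'l \<Rightarrow> real"
  assumes U: "finite U" "\<And>c. c \<in> U \<Longrightarrow> w c > 0"
    and inj: "\<And>c d u. c \<in> U \<Longrightarrow> d \<in> U \<Longrightarrow> x c \<le> u \<Longrightarrow> u < x c + w c \<Longrightarrow> x d \<le> u \<Longrightarrow> u < x d + w d \<Longrightarrow> c = d"
    and e: "\<And>u. E u \<longleftrightarrow> (\<exists>c\<in>U. x c \<le> u \<and> u < x c + w c)"
    and "\<And>u. u < p \<Longrightarrow> \<not> E u" "\<not> E q" "\<And>u. p \<le> u \<Longrightarrow> u < q \<Longrightarrow> E u"
  shows "line_tiling {c \<in> U. x c < q} w x p q"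
  unfolding line_tiling_def
proof
  fix u
  show "(\<Sum>c\<in>{c \<in> U. x c < q}. ind (x c) (x c + w c) u) = ind p q u"
  proof (cases "p \<le> u \<and> u < q")
    case True
    then obtain c where c: "c \<in> U" "x c \<le> u" "u < x c + w c"
      using assms(7) e by blast
    then have "\<exists>!c. c \<in> {c \<in> U. x c < q} \<and> x c \<le> u \<and> u < x c + w c"
      using True inj by (intro ex1I[of _ c]) auto
    then show ?thesis
      using sum_of_bool_ex1[of "{c \<in> U. x c < q}" "\<lambda>c. x c \<le> u \<and> u < x c + w c"] U(1) True
      by (simp add: ind_def)
  next
    case False
    have "\<not> (x c \<le> u \<and> u < x c + w c)" if "c \<in> U" "x c < q" for c
    proof
      assume cu: "x c \<le> u \<and> u < x c + w c"
      then have "E u"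
        using e that by blast
      then have "p \<le> u"
        using assms(5) by force
      then have "q \<le> u"
        using False by auto
      then have "E q"
        using e that cu by fastforce
      then show False
        using assms(6) by blast
    qed
    then show ?thesis
      using False by (auto simp: ind_def intro!: sum.neutral)
  qed
qed

section \<open>Pushing a layer to the bottom\<close>

text \<open>At the corner of a tile the sum of indicators is positive, so the corner lies in the
  rectangle; the vertical line through it bounds the tile vertically, and reflection gives the
  horizontal bounds.\<close>

lemma tiling_bounds:
  assumes L: "finite L" "\<And>c. c \<in> L \<Longrightarrow> w c > 0" "\<And>c. c \<in> L \<Longrightarrow> h c > 0"
    and tile: "tiling L w h s X0 X1 Y0 Y1" and c: "c \<in> L"
  shows "X0 \<le> fst (s c)" "fst (s c) + w c \<le> X1" "Y0 \<le> snd (s c)" "snd (s c) + h c \<le> Y1"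
proof -
  have inside: "X0 \<le> fst (s c) \<and> fst (s c) < X1"
    if "finite L" "\<And>c. c \<in> L \<Longrightarrow> w c > 0" "\<And>c. c \<in> L \<Longrightarrow> h c > 0"
      "tiling L w h s X0 X1 Y0 Y1" "c \<in> L"
    for w h :: "'a \<Rightarrow> real" and s X0 X1 Y0 Y1
  proof (rule ccontr)
    assume "\<not> ?thesis"
    then have "(\<Sum>d\<in>L. ind (fst (s d)) (fst (s d) + w d) (fst (s c)) * ind (snd (s d)) (snd (s d) + h d) (snd (s c))) = 0"
      using that(4) by (auto simp: tiling_def ind_def)
    then have "ind (fst (s c)) (fst (s c) + w c) (fst (s c)) * ind (snd (s c)) (snd (s c) + h c) (snd (s c)) = 0"
      using that(1,5) by (subst (asm) sum_nonneg_eq_0_iff) (auto simp: ind_def)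
    then show False
      using that by (auto simp: ind_def)
  qed
  have top: "Y0 \<le> snd (s c) \<and> snd (s c) + h c \<le> Y1"
    if "finite L" "\<And>c. c \<in> L \<Longrightarrow> w c > 0" "\<And>c. c \<in> L \<Longrightarrow> h c > 0"
      "tiling L w h s X0 X1 Y0 Y1" "c \<in> L"
    for w h :: "'a \<Rightarrow> real" and s X0 X1 Y0 Y1
  proof -
    let ?K = "{d \<in> L. fst (s d) \<le> fst (s c) \<and> fst (s c) < fst (s d) + w d}"
    have K: "line_tiling ?K h (\<lambda>c. snd (s c)) Y0 Y1" "c \<in> ?K" "finite ?K"
      using tiling_slice[OF that(1,4)] inside[OF that] that by auto
    have h: "h d > 0" if "d \<in> ?K" for d
      using \<open>\<And>c. c \<in> L \<Longrightarrow> h c > 0\<close> that by blast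
    show ?thesis
      using line_tiling_bounds(1,2)[OF K(3) h K(1,2)] by blast
  qed
  show "Y0 \<le> snd (s c)" "snd (s c) + h c \<le> Y1"
    using top[OF L tile c] by auto
  show "X0 \<le> fst (s c)" "fst (s c) + w c \<le> X1"
    using top[OF L(1,3,2) tiling_transpose[OF tile] c] by auto
qed

lemma tiling_column:
  assumes L: "finite L" "\<And>c. c \<in> L \<Longrightarrow> w c > 0" "\<And>c. c \<in> L \<Longrightarrow> h c > 0"
    and tile: "tiling L w h s X0 X1 Y0 Y1" and c: "c \<in> L"
  shows "\<exists>K\<subseteq>L. c \<in> K \<and> line_tiling K h (\<lambda>d. snd (s d)) Y0 Y1"
proof -
  have "fst (s c) < X1" "X0 \<le> fst (s c)"
    using tiling_bounds[OF L tile c] L(2)[OF c] by auto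
  then show ?thesis
    using tiling_slice[OF L(1) tile] L(2) c
    by (intro exI[of _ "{d \<in> L. fst (s d) \<le> fst (s c) \<and> fst (s c) < fst (s d) + w d}"]) auto
qed

context
  fixes L :: "'l set" and w h :: "'l \<Rightarrow> real" and \<beta> X0 X1 Y0 Y1 :: real
  assumes L: "finite L" "\<And>c. c \<in> L \<Longrightarrow> w c > 0" "\<And>c. c \<in> L \<Longrightarrow> h c > 0"
    and indep: "Q_lin_indep (w ` L)" "Q_lin_indep (h ` L)"
begin

text \<open>Says that \<open>\<beta>\<close> has coefficient \<open>0\<close> in \<open>t\<close>; by independence the choice of \<open>A\<close> does not matter.\<close>

private definition free :: "real \<Rightarrow> bool" where
  "free t \<longleftrightarrow> (\<exists>A\<subseteq>L. (\<forall>c\<in>A. h c \<noteq> \<beta>) \<and> sum h A = t)"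

text \<open>By independence the total height of a set of tiles determines how many of them have
  height \<beta>.\<close>

private lemma free_sum:
  assumes "A \<subseteq> L"
  shows "free (sum h A) \<longleftrightarrow> (\<forall>c\<in>A. h c \<noteq> \<beta>)"
proof
  assume "free (sum h A)"
  then obtain B where B: "B \<subseteq> L" "\<forall>c\<in>B. h c \<noteq> \<beta>" "sum h B = sum h A"
    unfolding free_def by blast
  have "card {c \<in> A. h c = \<beta>} = card {c \<in> B. h c = \<beta>}"
    using card_eq_of_sum_eq[OF L(1) indep(2) assms B(1)] B(3) by simp
  also have "{c \<in> B. h c = \<beta>} = {}"
    using B(2) by blast
  finally have "{c \<in> A. h c = \<beta>} = {}"
    using finite_subset[OF assms L(1)] by simp
  then show "\<forall>c\<in>A. h c \<noteq> \<beta>"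
    by blast
qed (use assms in \<open>auto simp: free_def\<close>)

text \<open>Compares the stack below \<open>c\<close> in a column with the same stack including
  \<open>c\<close>.\<close>

private lemma free_top:
  assumes "tiling L w h s X0 X1 Y0 Y1" "c \<in> L"
  shows "free (snd (s c) + h c - Y0) \<longleftrightarrow> h c \<noteq> \<beta> \<and> free (snd (s c) - Y0)"
proof -
  obtain K where K: "K \<subseteq> L" "c \<in> K" "line_tiling K h (\<lambda>d. snd (s d)) Y0 Y1"
    using tiling_column[OF L assms] by blast
  have fin: "finite K" "\<And>d. d \<in> K \<Longrightarrow> h d > 0"
    using K(1) L finite_subset by auto
  let ?A = "{d \<in> K. snd (s d) < snd (s c)}"
  have A: "sum h ?A = snd (s c) - Y0"
    using line_tiling_sum_below[OF fin K(3,2)] .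
  then have cA: "sum h (insert c ?A) = snd (s c) + h c - Y0"
    using fin by simp
  have sub: "?A \<subseteq> L" "insert c ?A \<subseteq> L"
    using K by auto
  show ?thesis
    using free_sum[OF sub(1)] free_sum[OF sub(2)] unfolding A cA by auto
qed

text \<open>Induction on the number of tiles in \<open>Low\<close>: each round lifts a tile of
  \<open>Low\<close> past a tile of the layer and thereby out of \<open>Low\<close>.\<close>

lemma bottom_row:
  assumes "tiling L w h s X0 X1 Y0 Y1" and c0: "c0 \<in> L" "h c0 = \<beta>"
  shows "\<exists>s'. moves L w h s s' \<and> (\<forall>c\<in>L. snd (s' c) = Y0 \<longrightarrow> h c = \<beta>)"
  using assms(1)
proof (induction "card {c \<in> L. free (snd (s c) + h c - Y0)}" arbitrary: s rule: less_induct)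
  case less
  note tile = less.prems
  have bounds: "X0 \<le> fst (s c)" "fst (s c) + w c \<le> X1" "Y0 \<le> snd (s c)" "snd (s c) + h c \<le> Y1"
    if "c \<in> L" for c
    using tiling_bounds[OF L tile that] by blast+
  \<comment> \<open>by \<open>free_top\<close>, the tiles strictly below the lowest layer of height \<open>\<beta>\<close>\<close>
  define Low where "Low s = {c \<in> L. free (snd (s c) + h c - Y0)}" for s :: "'l \<Rightarrow> real \<times> real"
  show ?case
  proof (cases "Low s = {}")
    case True
    \<comment> \<open>The empty stack shows that the bottom side is free, so a tile on it with
      height other than \<beta> would be in \<open>Low\<close>.\<close>
    have "free 0"
      unfolding free_def by (intro exI[of _ "{}"]) simp
    then have "h c = \<beta>" if "c \<in> L" "snd (s c) = Y0" for c
      using True free_top[OF tile that(1)] that by (auto simp: Low_def)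
    then show ?thesis
      by blast
  next
    case False
    have "finite (Low s)"
      using L(1) by (simp add: Low_def)
    then obtain a0 where a0: "a0 \<in> Low s"
      and a0_max: "\<And>c. c \<in> Low s \<Longrightarrow> snd (s c) + h c \<le> snd (s a0) + h a0"
      using ex_max_on[OF _ False, of "\<lambda>c. snd (s c) + h c"] by blast
    define t where "t = snd (s a0) + h a0"
    have free_t: "free (t - Y0)"
      using a0 by (simp add: t_def Low_def)
    have a0_L: "a0 \<in> L"
      using a0 by (simp add: Low_def)
    have t_gt: "Y0 < t"
      using bounds(3)[OF a0_L] L(3)[OF a0_L] by (simp add: t_def)
    \<comment> \<open>A column through \<open>c0\<close> contains a tile of height \<beta>, so the
      full height is not free.\<close>
    have t_lt: "t < Y1"
    proof (rule ccontr)
      assume "\<not> t < Y1"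
      then have "t = Y1"
        using bounds(4)[OF a0_L] by (simp add: t_def)
      obtain K where K: "K \<subseteq> L" "c0 \<in> K" "line_tiling K h (\<lambda>d. snd (s d)) Y0 Y1"
        using tiling_column[OF L tile c0(1)] by blast
      have "finite K" "\<And>d. d \<in> K \<Longrightarrow> h d > 0"
        using K(1) L finite_subset by auto
      then have "sum h K = Y1 - Y0"
        using line_tiling_sum[of K h "\<lambda>d. snd (s d)" Y0 Y1] K(3) t_gt \<open>t = Y1\<close> by auto
      then show False
        using free_sum[OF K(1)] free_t \<open>t = Y1\<close> K(2) c0(2) by auto
    qed
    define D where "D = {c \<in> L. snd (s c) + h c = t}"
    define U where "U = {c \<in> L. snd (s c) = t}"
    \<comment> \<open>Otherwise the top of \<open>c\<close> would be free and higher than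
      \<open>t\<close>, against the choice of \<open>a0\<close>.\<close>
    have U_\<beta>: "h c = \<beta>" if "c \<in> U" for c
    proof (rule ccontr)
      assume "h c \<noteq> \<beta>"
      then have "c \<in> Low s"
        using that free_t free_top[OF tile, of c] by (auto simp: U_def Low_def)
      then show False
        using a0_max[of c] that L(3)[of c] by (auto simp: U_def t_def)
    qed
    \<comment> \<open>The part of level \<open>t\<close> covered by top edges. \<open>E_U\<close>
      shows that bottom edges cover the same part: on each vertical line a tile ending at
      \<open>t\<close> is followed by one starting there, and conversely.\<close>
    define E where "E u \<longleftrightarrow> (\<exists>c\<in>D. fst (s c) \<le> u \<and> u < fst (s c) + w c)" for u
    define K where "K u = {c \<in> L. fst (s c) \<le> u \<and> u < fst (s c) + w c}" for u
    have K: "finite (K u)" "\<And>c. c \<in> K u \<Longrightarrow> h c > 0"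
        "line_tiling (K u) h (\<lambda>c. snd (s c)) Y0 Y1" if nonempty: "K u \<noteq> {}" for u
    proof -
      obtain c where c: "c \<in> K u"
        using nonempty by blast
      then have "X0 \<le> u" "u < X1"
        using bounds(1,2)[of c] by (auto simp: K_def)
      then show "line_tiling (K u) h (\<lambda>c. snd (s c)) Y0 Y1"
        using tiling_slice[OF L(1) tile] by (simp add: K_def)
      show "finite (K u)" "\<And>c. c \<in> K u \<Longrightarrow> h c > 0"
        using L by (auto simp: K_def)
    qed
    have E_U: "E u \<longleftrightarrow> (\<exists>c\<in>U. fst (s c) \<le> u \<and> u < fst (s c) + w c)" for u
    proof
      assume "E u"
      then obtain c where c: "c \<in> K u" "snd (s c) + h c = t"
        by (auto simp: E_def D_def K_def)
      then have ne: "K u \<noteq> {}"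
        by blast
      then obtain d where "d \<in> K u" "snd (s d) = t"
        using line_tiling_succ[OF K[OF ne] c(1)] c(2) t_lt by auto
      then show "\<exists>c\<in>U. fst (s c) \<le> u \<and> u < fst (s c) + w c"
        by (auto simp: U_def K_def)
    next
      assume "\<exists>c\<in>U. fst (s c) \<le> u \<and> u < fst (s c) + w c"
      then obtain c where c: "c \<in> K u" "snd (s c) = t"
        by (auto simp: U_def K_def)
      then have ne: "K u \<noteq> {}"
        by blast
      then obtain d where "d \<in> K u" "snd (s d) + h d = t"
        using line_tiling_pred[OF K[OF ne] c(1)] c(2) t_gt by auto
      then show "E u"
        by (auto simp: E_def D_def K_def)
    qed
    have fin: "finite D" "finite U" "\<And>c. c \<in> D \<Longrightarrow> w c > 0" "\<And>c. c \<in> U \<Longrightarrow> w c > 0"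
      using L by (auto simp: D_def U_def)
    have "a0 \<in> D"
      using a0_L by (simp add: D_def t_def)
    \<comment> \<open>The leftmost tile with top edge at \<open>t\<close>; its left end
      \<open>p\<close> is where the first component of \<open>E\<close> begins.\<close>
    then obtain a where a: "a \<in> D" and a_min: "\<And>c. c \<in> D \<Longrightarrow> fst (s a) \<le> fst (s c)"
      using ex_max_on[OF fin(1), of "\<lambda>c. - fst (s c)"] by auto
    define p where "p = fst (s a)"
    have a_L: "a \<in> L" "w a > 0" "snd (s a) + h a = t" "h a > 0"
      using a L by (auto simp: D_def)
    have "E p"
      using a a_L by (auto simp: E_def p_def)
    have "\<exists>q>p. \<not> E q \<and> (\<forall>u. p \<le> u \<and> u < q \<longrightarrow> E u)"
      using component_end[OF fin(1,3) E_def \<open>E p\<close>] by blast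
    then obtain q where q: "p < q" "\<not> E q" "\<And>u. p \<le> u \<Longrightarrow> u < q \<Longrightarrow> E u"
      by blast
    have below_p: "\<not> E u" if "u < p" for u
      using that a_min by (force simp: E_def p_def)
    define D' where "D' = {c \<in> D. fst (s c) < q}"
    define U' where "U' = {c \<in> U. fst (s c) < q}"
    have D'_tile: "line_tiling D' w (\<lambda>c. fst (s c)) p q"
      unfolding D'_def
    proof (rule component_line_tiling[OF fin(1,3), where E = E])
      fix c d u
      assume cd: "c \<in> D" "d \<in> D" "fst (s c) \<le> u" "u < fst (s c) + w c" "fst (s d) \<le> u" "u < fst (s d) + w d"
      then have cdK: "c \<in> K u" "d \<in> K u"
        by (auto simp: K_def D_def)
      then have ne: "K u \<noteq> {}"
        by blast
      moreover have "snd (s c) + h c = t" "snd (s d) + h d = t" "h c > 0" "h d > 0"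
        using cd L(3) by (auto simp: D_def)
      \<comment> \<open>Both tiles end at \<open>t\<close>, so on the line at \<open>u\<close> they
        share the higher of their two bottom points.\<close>
      ultimately show "c = d"
        using line_tiling_unique[OF K[OF ne] cdK(1) _ _ cdK(2), where t = "max (snd (s c)) (snd (s d))"] by auto
    qed (use E_def below_p q in auto)
    have U'_tile: "line_tiling U' w (\<lambda>c. fst (s c)) p q"
      unfolding U'_def
    proof (rule component_line_tiling[OF fin(2,4), where E = E])
      fix c d u
      assume cd: "c \<in> U" "d \<in> U" "fst (s c) \<le> u" "u < fst (s c) + w c" "fst (s d) \<le> u" "u < fst (s d) + w d"
      then have cdK: "c \<in> K u" "d \<in> K u"
        by (auto simp: K_def U_def)
      then have ne: "K u \<noteq> {}"
        by blast
      then show "c = d"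
        using line_tiling_inj[OF K[OF ne] cdK] cd by (auto simp: U_def)
    qed (use E_U below_p q in auto)
    have sub: "D' \<subseteq> L" "U' \<subseteq> L" "finite D'" "finite U'" "\<And>c. c \<in> D' \<Longrightarrow> w c > 0" "\<And>c. c \<in> U' \<Longrightarrow> w c > 0"
      using fin L(1) by (auto simp: D'_def U'_def D_def U_def)
    \<comment> \<open>Both sides of the component have the same total width, so \<open>a\<close> has
      a partner \<open>b\<close> of its width above the level.\<close>
    have "sum w U' = q - p" "sum w D' = q - p"
      using line_tiling_sum[OF sub(4,6) U'_tile] line_tiling_sum[OF sub(3,5) D'_tile] q(1) by auto
    moreover have "a \<in> D'"
      using a q(1) by (simp add: D'_def p_def)
    ultimately obtain b where b: "b \<in> U'" "w b = w a"
      using ex_same_of_sum_eq[OF L(1) indep(1) sub(1,2), of a] by auto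
    have b_L: "b \<in> L" "h b = \<beta>"
      using b(1) U_\<beta> by (auto simp: U'_def U_def)
    have U'_eq: "h c = \<beta>" "snd (s c) = t" if "c \<in> U'" for c
      using that U_\<beta> by (auto simp: U'_def U_def)
    \<comment> \<open>Sliding \<open>b\<close> to the left end of its row puts it directly above
      \<open>a\<close>.\<close>
    obtain s1 where s1: "moves U' w h s s1" "\<forall>c\<in>U'. snd (s1 c) = t" "fst (s1 b) = p"
      using row_bubble[where h = h, OF sub(4,6) U'_eq U'_tile b(1)] by blast
    have a_U': "a \<notin> U'"
      using a_L by (auto simp: U'_def U_def)
    have s1_a: "s1 a = s a"
      using moves_outside[OF s1(1) a_U'] .
    have s1_b: "s1 b = (p, t)"
      using s1 b(1) by (simp add: prod_eq_iff)
    have ab: "a \<noteq> b"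
      using a_U' b(1) by blast
    have s1_y: "snd (s1 c) = snd (s c)" for c
      using s1(2) moves_outside[OF s1(1), of c] by (cases "c \<in> U'") (auto simp: U'_def U_def)
    define s2 where "s2 = s1(a := (p, snd (s a) + h b), b := s a)"
    have "hstep L h w (prod.swap \<circ> s1) (prod.swap \<circ> s2)"
      unfolding hstep_def
      by (rule bexI[OF _ a_L(1)], rule bexI[OF _ b_L(1)])
        (use ab s1_a s1_b b(2) a_L(3) in \<open>auto simp: s2_def fun_eq_iff p_def\<close>)
    then have "moves L w h s1 s2"
      by (simp add: step_def r_into_rtranclp)
    then have s2: "moves L w h s s2"
      using moves_mono[OF sub(2) s1(1)] by (rule rtranclp_trans[rotated])
    have tile2: "tiling L w h s2 X0 X1 Y0 Y1"
      using tiling_moves[OF s2 tile L] .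
    \<comment> \<open>The new top of \<open>b\<close>, which is the new bottom of \<open>a\<close>,
      is not free because \<open>b\<close> has height \<beta>; hence \<open>a\<close> leaves
      \<open>Low\<close> and \<open>b\<close> does not enter it.\<close>
    have not_free: "\<not> free (snd (s a) + h b - Y0)"
      using free_top[OF tile2 b_L(1)] b_L(2) by (simp add: s2_def)
    have "c \<in> Low s" "c \<noteq> a" if c: "c \<in> Low s2" for c
    proof -
      have "c \<noteq> b"
        using c not_free by (auto simp: Low_def s2_def)
      moreover show "c \<noteq> a"
        using c not_free free_top[OF tile2 a_L(1)] ab by (auto simp: Low_def s2_def)
      ultimately show "c \<in> Low s"
        using c s1_y by (auto simp: Low_def s2_def)
    qed
    moreover have "a \<in> Low s"
      using a_L free_t by (simp add: Low_def)
    ultimately have "Low s2 \<subset> Low s"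
      by blast
    then have "card (Low s2) < card (Low s)"
      using \<open>finite (Low s)\<close> by (rule psubset_card_mono[rotated])
    then obtain s' where "moves L w h s2 s'" "\<forall>c\<in>L. snd (s' c) = Y0 \<longrightarrow> h c = \<beta>"
      using less.hyps[of s2] tile2 by (auto simp: Low_def)
    then show ?thesis
      using s2 rtranclp_trans[of "step L w h" s s2 s'] by blast
  qed
qed

end

section \<open>Interchanging tiles of the same shape\<close>

definition sizes :: "'l set \<Rightarrow> ('l \<Rightarrow> real) \<Rightarrow> ('l \<Rightarrow> real) \<Rightarrow> bool" where
  "sizes L w h \<longleftrightarrow> finite L \<and> (\<forall>c\<in>L. w c > 0) \<and> (\<forall>c\<in>L. h c > 0)
    \<and> Q_lin_indep (w ` L) \<and> Q_lin_indep (h ` L)"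

lemma sizes_mono:
  assumes "sizes L w h" "K \<subseteq> L"
  shows "sizes K w h"
proof -
  have "Q_lin_indep (g ` K)" if "Q_lin_indep (g ` L)" for g :: "'a \<Rightarrow> real"
    using that image_mono[OF assms(2), of g] unfolding Q_lin_indep_def by (meson order_trans)
  then show ?thesis
    using assms finite_subset unfolding sizes_def by blast
qed

lemma sizes_transpose: "sizes L w h \<Longrightarrow> sizes L h w"
  by (auto simp: sizes_def)

lemma sizesD:
  assumes "sizes L w h"
  shows "finite L" "\<And>c. c \<in> L \<Longrightarrow> w c > 0" "\<And>c. c \<in> L \<Longrightarrow> h c > 0"
    "Q_lin_indep (w ` L)" "Q_lin_indep (h ` L)"
  using assms by (auto simp: sizes_def)

text \<open>\<open>B \<noteq> {}\<close> makes \<open>L - B\<close> a proper subset, to which an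
  induction hypothesis applies.\<close>

definition bottom_strip ::
    "'l set \<Rightarrow> ('l \<Rightarrow> real) \<Rightarrow> ('l \<Rightarrow> real) \<Rightarrow> real \<Rightarrow> ('l \<Rightarrow> real \<times> real) \<Rightarrow> real \<Rightarrow> real \<Rightarrow> real \<Rightarrow> real \<Rightarrow> 'l set \<Rightarrow> bool"
  where "bottom_strip L w h \<beta> s X0 X1 Y0 Y1 B \<longleftrightarrow> B \<subseteq> L \<and> B \<noteq> {} \<and> (\<forall>c\<in>B. h c = \<beta> \<and> snd (s c) = Y0)
    \<and> line_tiling B w (\<lambda>c. fst (s c)) X0 X1 \<and> tiling (L - B) w h s X0 X1 (Y0 + \<beta>) Y1"

lemma bottom_stripD:
  assumes "bottom_strip L w h \<beta> s X0 X1 Y0 Y1 B"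
  shows "B \<subseteq> L" "B \<noteq> {}" "\<And>c. c \<in> B \<Longrightarrow> h c = \<beta>" "\<And>c. c \<in> B \<Longrightarrow> snd (s c) = Y0"
    "line_tiling B w (\<lambda>c. fst (s c)) X0 X1" "tiling (L - B) w h s X0 X1 (Y0 + \<beta>) Y1"
  using assms by (auto simp: bottom_strip_def)

lemma reach_bottom_strip:
  assumes sz: "sizes L w h" and tile: "tiling L w h s X0 X1 Y0 Y1" and c0: "c0 \<in> L" "h c0 = \<beta>"
  shows "\<exists>s' B. moves L w h s s' \<and> tiling L w h s' X0 X1 Y0 Y1 \<and> bottom_strip L w h \<beta> s' X0 X1 Y0 Y1 B"
proof -
  note L = sizesD[OF sz]
  obtain s' where s': "moves L w h s s'" "\<forall>c\<in>L. snd (s' c) = Y0 \<longrightarrow> h c = \<beta>"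
    using bottom_row[OF L tile c0] by blast
  have tile': "tiling L w h s' X0 X1 Y0 Y1"
    using tiling_moves[OF s'(1) tile L(1-3)] .
  have bounds: "X0 \<le> fst (s' c)" "fst (s' c) + w c \<le> X1" "Y0 \<le> snd (s' c)" "snd (s' c) + h c \<le> Y1"
    if "c \<in> L" for c
    using tiling_bounds[OF L(1-3) tile' that] by blast+
  have Y: "Y0 < Y1" and X: "X0 < X1"
    using bounds[OF c0(1)] L(2,3)[OF c0(1)] by linarith+
  define B where "B = {c \<in> L. snd (s' c) = Y0}"
  \<comment> \<open>The line at the bottom side meets exactly the tiles standing on it.\<close>
  have "{c \<in> L. snd (s' c) \<le> Y0 \<and> Y0 < snd (s' c) + h c} = B"
    using bounds(3) L(3) by (force simp: B_def)
  then have B: "line_tiling B w (\<lambda>c. fst (s' c)) X0 X1"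
    using tiling_slice[OF L(1) tiling_transpose[OF tile'], of Y0] Y by simp
  have B_L: "B \<subseteq> L" and B_\<beta>: "\<And>c. c \<in> B \<Longrightarrow> h c = \<beta>" and B_Y: "\<And>c. c \<in> B \<Longrightarrow> snd (s' c) = Y0"
    using s'(2) by (auto simp: B_def)
  have fin: "finite B" "\<And>c. c \<in> B \<Longrightarrow> w c > 0"
    using B_L L finite_subset by auto
  obtain d where d: "d \<in> B"
    using line_tiling_cover[OF fin B, of X0] X by auto
  have \<beta>: "0 < \<beta>" "Y0 + \<beta> \<le> Y1"
    using bounds(4)[of d] L(3)[of d] d B_\<beta>[OF d] B_Y[OF d] B_L by auto
  have "tiling (L - B) w h s' X0 X1 (Y0 + \<beta>) Y1"
    unfolding tiling_def
  proof (intro allI)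
    fix u v
    let ?g = "\<lambda>c. ind (fst (s' c)) (fst (s' c) + w c) u * ind (snd (s' c)) (snd (s' c) + h c) v"
    have "sum ?g B = (\<Sum>c\<in>B. ind (fst (s' c)) (fst (s' c) + w c) u * ind Y0 (Y0 + \<beta>) v)"
      by (rule sum.cong) (auto simp: B_\<beta> B_Y)
    also have "\<dots> = ind X0 X1 u * ind Y0 (Y0 + \<beta>) v"
      using B by (simp add: line_tiling_def flip: sum_distrib_right)
    \<comment> \<open>The strip is subtracted from the indicator identity;
      \<open>Y0 + \<beta> \<le> Y1\<close> makes the difference the indicator of the remaining
      rectangle.\<close>
    finally have "sum ?g (L - B) = ind X0 X1 u * ind Y0 Y1 v - ind X0 X1 u * ind Y0 (Y0 + \<beta>) v"
      using tile' sum_diff[OF L(1) B_L, of ?g] by (simp add: tiling_def)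
    then show "sum ?g (L - B) = ind X0 X1 u * ind (Y0 + \<beta>) Y1 v"
      using \<beta> by (auto simp: ind_def)
  qed
  then show ?thesis
    using s'(1) tile' B d B_L B_\<beta> B_Y unfolding bottom_strip_def by blast
qed

abbreviation exchange :: "'a \<Rightarrow> 'a \<Rightarrow> 'a \<Rightarrow> 'a" where
  "exchange \<equiv> Transposition.transpose"

lemma exchange_same:
  "f a = f b \<Longrightarrow> f (exchange a b c) = f c"
  by (simp add: Transposition.transpose_def)

text \<open>The way back from \<open>t\<close> is the reversed first leg with \<open>a\<close> and
  \<open>b\<close> relabelled, so the interchange may be carried out in any reachable
  placement.\<close>

lemma moves_exchange_conjugate:
  assumes "moves L w h s t" "moves L w h t (t \<circ> exchange a b)"
    and "a \<in> L" "b \<in> L" "w a = w b" "h a = h b"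
  shows "moves L w h s (s \<circ> exchange a b)"
proof -
  have "moves L w h (t \<circ> exchange a b) (s \<circ> exchange a b)"
    using assms by (intro moves_relabel moves_sym[OF assms(1)]) (auto simp: exchange_same Transposition.transpose_def)
  then show ?thesis
    using assms(1,2) rtranclp_trans by metis
qed

text \<open>After a bottom strip of the common height is split off, tiles on the same side are
  interchanged within the strip or within the rest; otherwise both are first brought into one column
  along the left side.\<close>

lemma swap_same_shape:
  assumes sz: "sizes L w h" and tile: "tiling L w h s X0 X1 Y0 Y1"
    and IH: "\<And>K s s' X0 X1 Y0 Y1. K \<subset> L \<Longrightarrow> tiling K w h s X0 X1 Y0 Y1 \<Longrightarrow> tiling K w h s' X0 X1 Y0 Y1
      \<Longrightarrow> (\<And>c. c \<notin> K \<Longrightarrow> s c = s' c) \<Longrightarrow> moves K w h s s'"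
    and ab: "a \<in> L" "b \<in> L" "w a = w b" "h a = h b"
  shows "moves L w h s (s \<circ> exchange a b)"
proof -
  obtain t B where t: "moves L w h s t" "tiling L w h t X0 X1 Y0 Y1"
      and strip: "bottom_strip L w h (h a) t X0 X1 Y0 Y1 B"
    using reach_bottom_strip[OF sz tile ab(1)] by blast
  note B = bottom_stripD[OF strip]
  note L = sizesD[OF sz]
  define M where "M = L - B"
  have M: "M \<subset> L" "M \<inter> B = {}"
    using B(1,2) by (auto simp: M_def)
  note tile_M = B(6)[folded M_def]
  have sz_M: "sizes M w h" and sz_B: "sizes B w h"
    using sizes_mono[OF sz] M B(1) by auto
  note M' = sizesD[OF sz_M]
  note B' = sizesD[OF sz_B]
  \<comment> \<open>The names are rebound, so that the case with the roles of the two tiles reversed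
    is covered as well.\<close>
  have mixed: "moves L w h t (t \<circ> exchange a b)"
    if a: "a \<in> B" and b: "b \<in> M" and ab_eq: "w a = w b" "h a = h b" for a b
  proof -
    define \<beta> where "\<beta> = h b"
    have \<beta>: "h c = \<beta>" if "c \<in> B" for c
      using B(3)[OF that] B(3)[OF a] ab_eq by (simp add: \<beta>_def)
    have tile_M: "tiling M w h t X0 X1 (Y0 + \<beta>) Y1"
      using tile_M B(3)[OF a] ab_eq by (simp add: \<beta>_def)
    \<comment> \<open>Reflected, a bottom strip of height \<open>w b\<close> is a column of width
      \<open>w b\<close> along the left side.\<close>
    obtain s2' C where s2': "moves M h w (prod.swap \<circ> t) s2'" "tiling M h w s2' (Y0 + \<beta>) Y1 X0 X1"
        and C: "bottom_strip M h w (w b) s2' (Y0 + \<beta>) Y1 X0 X1 C"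
      using reach_bottom_strip[OF sizes_transpose[OF sz_M] tiling_transpose[OF tile_M] b] by blast
    define s2 where "s2 = prod.swap \<circ> s2'"
    have s2: "moves M w h t s2" "tiling M w h s2 X0 X1 (Y0 + \<beta>) Y1"
      using moves_transpose[OF s2'(1)] tiling_transpose[OF s2'(2)] by (simp_all add: s2_def)
    note C = bottom_stripD[OF C]
    have C_s2: "\<And>c. c \<in> C \<Longrightarrow> w c = w b" "\<And>c. c \<in> C \<Longrightarrow> fst (s2 c) = X0"
        "line_tiling C h (\<lambda>c. snd (s2 c)) (Y0 + \<beta>) Y1"
      using C(3-5) by (simp_all add: s2_def)
    \<comment> \<open>A column through \<open>b\<close> and the left column have equal total height,
      so the latter contains a tile \<open>c\<close> shaped like \<open>b\<close>.\<close>
    obtain K where K: "K \<subseteq> M" "b \<in> K" "line_tiling K h (\<lambda>d. snd (s2 d)) (Y0 + \<beta>) Y1"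
      using tiling_column[OF M'(1-3) s2(2) b] by blast
    have Y: "Y0 + \<beta> \<le> Y1"
      using tiling_bounds(3,4)[OF M'(1-3) s2(2) b] M'(3)[OF b] by linarith
    have pos: "\<And>c. c \<in> K \<Longrightarrow> h c > 0" "\<And>c. c \<in> C \<Longrightarrow> h c > 0"
      using K(1) C(1) M'(3) by auto
    have "sum h K = Y1 - (Y0 + \<beta>)" "sum h C = Y1 - (Y0 + \<beta>)"
      using line_tiling_sum[OF finite_subset[OF K(1) M'(1)] pos(1) K(3) Y]
        line_tiling_sum[OF finite_subset[OF C(1) M'(1)] pos(2) C_s2(3) Y] by auto
    then obtain c where c: "c \<in> C" "h c = h b"
      using ex_same_of_sum_eq[OF M'(1,5) K(1) C(1) _ K(2)] by auto
    have c_M: "c \<in> M"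
      using c C(1) by blast
    define \<pi> where "\<pi> = exchange b c"
    have \<pi>: "\<pi> (\<pi> d) = d" "w (\<pi> d) = w d" "h (\<pi> d) = h d" "\<pi> ` M = M" "\<pi> b = c" "\<pi> c = b" for d
      using c c_M b C_s2(1) by (auto simp: \<pi>_def exchange_same)
    have \<pi>_out: "\<pi> d = d" if "d \<notin> M" for d
      using that b c_M by (auto simp: \<pi>_def Transposition.transpose_def)
    \<comment> \<open>In \<open>s3\<close> tile \<open>b\<close> has the place of \<open>c\<close>
      in the left column; the induction hypothesis reaches it since \<open>M\<close> is a proper
      subset.\<close>
    define s3 where "s3 = s2 \<circ> \<pi>"
    have "tiling M w h s3 X0 X1 (Y0 + \<beta>) Y1"
      using tiling_relabel[OF s2(2), of \<pi>] \<pi> by (simp add: s3_def)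
    then have "moves M w h s2 s3"
      using s2(2) \<pi>_out by (intro IH[OF M(1)]) (auto simp: s3_def)
    then have t_s3: "moves M w h t s3"
      using s2(1) by (rule rtranclp_trans[rotated])
    have s3_B: "s3 d = t d" if "d \<in> B" for d
      using moves_outside[OF t_s3, of d] that M(2) by blast
    define C' where "C' = \<pi> ` C"
    have C': "b \<in> C'" "C' \<subseteq> M"
      using imageI[OF c(1), of \<pi>] \<pi>(6) image_mono[OF C(1), of \<pi>] \<pi>(4) by (simp_all add: C'_def)
    have C'_eq: "w d = w b" "fst (s3 d) = X0" if "d \<in> C'" for d
      using that C_s2(1,2) \<pi>(1,2) by (auto simp: C'_def s3_def)
    have C'_line: "line_tiling C' h (\<lambda>d. snd (s3 d)) (Y0 + \<beta>) Y1"
      using line_tiling_relabel[OF C_s2(3), of \<pi>] \<pi> by (simp add: C'_def s3_def)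
    have B_s3: "snd (s3 d) = Y0" if "d \<in> B" for d
      using s3_B B(4) that by simp
    have B_line: "line_tiling B w (\<lambda>d. fst (s3 d)) X0 X1"
      using B(5) s3_B by (simp add: line_tiling_def)
    \<comment> \<open>Within the bottom strip \<open>a\<close> slides to the left end, right under
      the left column.\<close>
    obtain s4 where s4: "moves B w h s3 s4" "\<forall>d\<in>B. snd (s4 d) = Y0" "fst (s4 a) = X0"
      using row_bubble[where h = h, OF B'(1,2) \<beta> B_s3 B_line a] by blast
    have s4_M: "s4 d = s3 d" if "d \<in> M" for d
      using moves_outside[OF s4(1), of d] that M(2) by blast
    have ts4: "moves L w h t s4"
      using moves_mono[OF psubset_imp_subset[OF M(1)] t_s3] moves_mono[OF B(1) s4(1)] by (rule rtranclp_trans)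
    define R where "R = insert a C'"
    have a_C': "a \<notin> C'"
      using C'(2) a M(2) by blast
    have fin_C': "finite C'"
      using C'(2) M'(1) finite_subset by blast
    have \<beta>_pos: "\<beta> > 0"
      using M'(3)[OF b] by (simp add: \<beta>_def)
    have R_line: "line_tiling R h (\<lambda>d. snd (s4 d)) Y0 Y1"
      unfolding line_tiling_def
    proof
      fix v
      have "(\<Sum>d\<in>C'. ind (snd (s4 d)) (snd (s4 d) + h d) v) = (\<Sum>d\<in>C'. ind (snd (s3 d)) (snd (s3 d) + h d) v)"
        using s4_M C'(2) by (intro sum.cong) auto
      also have "\<dots> = ind (Y0 + \<beta>) Y1 v"
        using C'_line by (simp add: line_tiling_def)
      finally have "(\<Sum>d\<in>R. ind (snd (s4 d)) (snd (s4 d) + h d) v) = ind Y0 (Y0 + \<beta>) v + ind (Y0 + \<beta>) Y1 v"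
        using a_C' fin_C' s4(2) a \<beta>[OF a] by (simp add: R_def)
      then show "(\<Sum>d\<in>R. ind (snd (s4 d)) (snd (s4 d) + h d) v) = ind Y0 Y1 v"
        using Y \<beta>_pos by (auto simp: ind_def)
    qed
    have R: "finite R" "R \<subseteq> L" "a \<in> R" "b \<in> R"
      using fin_C' C'(1,2) a B(1) M(1) by (auto simp: R_def)
    have R_eq: "w d = w b" "fst (s4 d) = X0" if "d \<in> R" for d
      using that C'_eq[of d] s4_M[of d] C'(2) s4(3) ab_eq(1) by (auto simp: R_def)
    have ex_R: "exchange a b ` R = R"
      using R(3,4) by auto
    have ex_mem: "exchange a b d \<in> R" if "d \<in> R" for d
      using that ex_R by blast
    \<comment> \<open>All tiles of \<open>R\<close> have width \<open>w b\<close> and left edge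
      \<open>X0\<close>, so reflected they form a row, which may be permuted freely.\<close>
    have "moves R h w (prod.swap \<circ> s4) (prod.swap \<circ> (s4 \<circ> exchange a b))"
    proof (rule row_connected[where y = X0 and p = Y0 and q = Y1 and \<beta> = "w b"])
      show "line_tiling R h (\<lambda>c. fst ((prod.swap \<circ> (s4 \<circ> exchange a b)) c)) Y0 Y1"
        using line_tiling_relabel[OF R_line, of "exchange a b"] ex_R exchange_same[of h a b, OF ab_eq(2)] by simp
      show "(prod.swap \<circ> s4) d = (prod.swap \<circ> (s4 \<circ> exchange a b)) d" if "d \<notin> R" for d
        using that R(3,4) by (auto simp: Transposition.transpose_def)
      show "w d = w b" if "d \<in> R" for d
        by (rule R_eq(1)[OF that])
    qed (use R R_eq(2) R_line ex_mem L(3) in auto)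
    from moves_mono[OF R(2) moves_transpose[OF this]] have "moves L w h s4 (s4 \<circ> exchange a b)"
      by simp
    then show ?thesis
      using ts4 ab_eq a b B(1) M(1) by (intro moves_exchange_conjugate[OF ts4]) auto
  qed
  have "moves L w h t (t \<circ> exchange a b)"
  proof -
    consider "a \<in> B" "b \<in> B" | "a \<in> B" "b \<in> M" | "a \<in> M" "b \<in> B" | "a \<in> M" "b \<in> M"
      using ab by (auto simp: M_def)
    then show ?thesis
    proof cases
      case 1
      have ex_mem: "exchange a b d \<in> B" if "d \<in> B" for d
        using that 1 by (auto simp: Transposition.transpose_def)
      have "moves B w h t (t \<circ> exchange a b)"
      proof (rule row_connected[where y = Y0 and p = X0 and q = X1 and \<beta> = "h a"])
        show "line_tiling B w (\<lambda>c. fst ((t \<circ> exchange a b) c)) X0 X1"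
          using line_tiling_relabel[OF B(5), of "exchange a b"] 1 exchange_same[of w a b, OF ab(3)] by simp
        show "t d = (t \<circ> exchange a b) d" if "d \<notin> B" for d
          using that 1 by (auto simp: Transposition.transpose_def)
      qed (use B B' ex_mem in auto)
      then show ?thesis
        by (rule moves_mono[OF B(1)])
    next
      case 2
      then show ?thesis
        using mixed ab by blast
    next
      case 3
      then show ?thesis
        using mixed[of b a] ab by (simp add: transpose_commute)
    next
      case 4
      have "tiling M w h (t \<circ> exchange a b) X0 X1 (Y0 + h a) Y1"
        using tiling_relabel[OF tile_M, of "exchange a b"] 4 exchange_same[of w a b, OF ab(3)] exchange_same[of h a b, OF ab(4)] by simp
      moreover have "t d = (t \<circ> exchange a b) d" if "d \<notin> M" for d
        using that 4 by (auto simp: Transposition.transpose_def)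
      ultimately have "moves M w h t (t \<circ> exchange a b)"
        using IH[OF M(1) tile_M] by blast
      then show ?thesis
        by (rule moves_mono[OF psubset_imp_subset[OF M(1)]])
    qed
  qed
  then show ?thesis
    using moves_exchange_conjugate[OF t(1)] ab by blast
qed

section \<open>Connectedness of the tilings\<close>

lemma bottom_strip_exchange:
  assumes strip: "bottom_strip L w h \<beta> s X0 X1 Y0 Y1 B" and ab: "a \<in> L" "b \<in> L" "w a = w b" "h a = h b"
  shows "bottom_strip L w h \<beta> (s \<circ> exchange a b) X0 X1 Y0 Y1 (exchange a b ` B)"
proof -
  note B = bottom_stripD[OF strip]
  note same = exchange_same[of w a b, OF ab(3)] exchange_same[of h a b, OF ab(4)]
  have L: "exchange a b ` L = L"
    using ab by simp
  have "line_tiling (exchange a b ` B) w (\<lambda>c. fst (s (exchange a b c))) X0 X1"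
    using line_tiling_relabel[OF B(5), of "exchange a b"] same by simp
  moreover have "exchange a b ` (L - B) = L - exchange a b ` B"
    using L image_set_diff[OF inj_transpose, of a b L B] by simp
  then have "tiling (L - exchange a b ` B) w h (s \<circ> exchange a b) X0 X1 (Y0 + \<beta>) Y1"
    using tiling_relabel[OF B(6), of "exchange a b"] same by simp
  moreover have "exchange a b ` B \<subseteq> L"
    using image_mono[OF B(1), of "exchange a b"] L by simp
  ultimately show ?thesis
    using B(2-4) same by (auto simp: bottom_strip_def)
qed

text \<open>Both placements are given a bottom strip of the same height; interchanges of equal tiles
  make the two strips consist of the same tiles, then strips and remaining rectangles are matched
  separately.\<close>

theorem tilings_connected:
  assumes "sizes L w h" "tiling L w h s X0 X1 Y0 Y1" "tiling L w h s' X0 X1 Y0 Y1"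
    and "\<And>c. c \<notin> L \<Longrightarrow> s c = s' c"
  shows "moves L w h s s'"
proof -
  have "finite L"
    using assms(1) by (simp add: sizes_def)
  then show ?thesis
    using assms
  proof (induction L arbitrary: s s' X0 X1 Y0 Y1 rule: finite_psubset_induct)
    case (psubset L)
    note sz = psubset.prems(1) and tile = psubset.prems(2,3)
    note L = sizesD[OF sz]
    have IH: "moves K w h s s'"
      if "K \<subset> L" "tiling K w h s X0 X1 Y0 Y1" "tiling K w h s' X0 X1 Y0 Y1" "\<And>c. c \<notin> K \<Longrightarrow> s c = s' c"
      for K s s' X0 X1 Y0 Y1
      using psubset.IH[OF that(1) sizes_mono[OF sz] that(2-4)] that(1) by blast
    show ?case
    proof (cases "L = {}")
      case True
      then have "s = s'"
        using psubset.prems(4) by auto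
      then show ?thesis
        by simp
    next
      case False
      then obtain c0 where c0: "c0 \<in> L"
        by blast
      define \<beta> where "\<beta> = h c0"
      obtain t B where t: "moves L w h s t" "tiling L w h t X0 X1 Y0 Y1"
          "bottom_strip L w h \<beta> t X0 X1 Y0 Y1 B"
        using reach_bottom_strip[OF sz tile(1) c0] \<beta>_def by blast
      obtain t' B' where t': "moves L w h s' t'" "tiling L w h t' X0 X1 Y0 Y1"
          "bottom_strip L w h \<beta> t' X0 X1 Y0 Y1 B'"
        using reach_bottom_strip[OF sz tile(2) c0] \<beta>_def by blast
      have agree: "t c = t' c" if "c \<notin> L" for c
        using moves_outside[OF t(1) that] moves_outside[OF t'(1) that] psubset.prems(4)[OF that] by simp
      note B = bottom_stripD[OF t(3)]
      have szB: "sizes B w h"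
        using sizes_mono[OF sz B(1)] .
      have X: "X0 \<le> X1"
        using tiling_bounds(1,2)[OF L(1-3) t(2) c0] L(2)[OF c0] by linarith
      have B_sum: "sum w B = X1 - X0"
        using line_tiling_sum[OF sizesD(1,2)[OF szB] B(5) X] by blast
      have M: "L - B \<subset> L"
        using B(1,2) by blast
      have "moves L w h t t'"
        using t'(2,3) agree
      \<comment> \<open>Each interchange brings a tile of \<open>B\<close> into the strip
        \<open>B'\<close>, so \<open>B - B'\<close> shrinks.\<close>
      proof (induction "card (B - B')" arbitrary: t' B' rule: less_induct)
        case less
        note B' = bottom_stripD[OF less.prems(2)]
        have szB': "sizes B' w h"
          using sizes_mono[OF sz B'(1)] .
        have B'_sum: "sum w B' = X1 - X0"
          using line_tiling_sum[OF sizesD(1,2)[OF szB'] B'(5) X] by blast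
        show ?case
        proof (cases "B \<subseteq> B'")
          case True
          \<comment> \<open>The strips have equal total width, so a proper inclusion is
            impossible.\<close>
          have "B = B'"
          proof (rule ccontr)
            assume "B \<noteq> B'"
            then obtain b where "b \<in> B' - B"
              using True by blast
            then have "sum w B < sum w B'"
              using sizesD(1,2)[OF szB'] True
              by (intro sum_strict_mono2[of B' B b]) (auto simp: less_imp_le)
            then show False
              using B_sum B'_sum by simp
          qed
          \<comment> \<open>The intermediate placement, with the strip already as in
            \<open>t'\<close> and the rest still as in \<open>t\<close>.\<close>
          define r where "r c = (if c \<in> B then t' c else t c)" for c
          have "moves B w h t r"
          proof (rule row_connected[where y = Y0 and p = X0 and q = X1 and \<beta> = \<beta>])
            show "line_tiling B w (\<lambda>c. fst (r c)) X0 X1"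
              using B'(5) \<open>B = B'\<close> by (simp add: line_tiling_def r_def)
          qed (use B B' \<open>B = B'\<close> sizesD[OF szB] in \<open>auto simp: r_def\<close>)
          moreover have "moves (L - B) w h r t'"
          proof (rule IH[OF M])
            show "tiling (L - B) w h r X0 X1 (Y0 + \<beta>) Y1"
              using B(6) by (simp add: tiling_def r_def)
            show "tiling (L - B) w h t' X0 X1 (Y0 + \<beta>) Y1"
              using B'(6) \<open>B = B'\<close> by simp
          qed (use less.prems(3) in \<open>auto simp: r_def\<close>)
          ultimately show ?thesis
            using moves_mono[OF B(1)] moves_mono[OF psubset_imp_subset[OF M]] rtranclp_trans by metis
        next
          case False
          then obtain a where a: "a \<in> B" "a \<notin> B'"
            by blast
          \<comment> \<open>Both strips contain equally many tiles as wide as \<open>a\<close>;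
            since \<open>a\<close> is missing from \<open>B'\<close>, some such tile of
            \<open>B'\<close> is missing from \<open>B\<close>.\<close>
          have card_eq: "card {c \<in> B. w c = w a} = card {c \<in> B'. w c = w a}"
            using card_eq_of_sum_eq[OF L(1,4) B(1) B'(1)] B_sum B'_sum by simp
          have "\<not> {c \<in> B'. w c = w a} \<subseteq> {c \<in> B. w c = w a}"
          proof
            assume "{c \<in> B'. w c = w a} \<subseteq> {c \<in> B. w c = w a}"
            then have "{c \<in> B'. w c = w a} = {c \<in> B. w c = w a}"
              using card_eq sizesD(1)[OF szB] by (intro card_subset_eq) auto
            then show False
              using a by blast
          qed
          then obtain b where b: "b \<in> B'" "b \<notin> B" "w b = w a"
            by blast
          have ab: "a \<in> L" "b \<in> L" "w a = w b" "h a = h b"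
            using a b B(1,3) B'(1,3) b(3)[symmetric] by auto
          have "exchange a b ` B' = insert a (B' - {b})"
            using a(1,2) b(1,2) by (auto simp: Transposition.transpose_def image_iff)
          then have "B - exchange a b ` B' \<subset> B - B'"
            using a(1,2) b(1,2) by auto
          then have "card (B - exchange a b ` B') < card (B - B')"
            using sizesD(1)[OF szB] by (intro psubset_card_mono) auto
          moreover have "tiling L w h (t' \<circ> exchange a b) X0 X1 Y0 Y1"
            using tiling_relabel[OF less.prems(1), of "exchange a b"] ab(1,2)
              exchange_same[of w a b, OF ab(3)] exchange_same[of h a b, OF ab(4)] by simp
          moreover have "t c = (t' \<circ> exchange a b) c" if "c \<notin> L" for c
            using that less.prems(3) ab(1,2) by (auto simp: Transposition.transpose_def)
          ultimately have "moves L w h t (t' \<circ> exchange a b)"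
            using less.hyps[OF _ _ bottom_strip_exchange[OF less.prems(2) ab]] by blast
          moreover have "moves L w h t' (t' \<circ> exchange a b)"
            by (rule swap_same_shape[OF sz less.prems(1) _ ab]) (rule IH)
          ultimately show ?thesis
            using moves_sym rtranclp_trans by metis
        qed
      qed
      then show ?thesis
        using t(1) moves_sym[OF t'(1)] rtranclp_trans by metis
    qed
  qed
qed

section \<open>Restricted shuffles\<close>

definition corner :: "real \<times> real \<Rightarrow> real^2" where
  "corner p = vector [fst p, snd p]"

lemma corner_nth [simp]: "corner p $ 1 = fst p" "corner p $ 2 = snd p"
  by (simp_all add: corner_def vector_2)

definition tile :: "('l \<Rightarrow> real) \<Rightarrow> ('l \<Rightarrow> real) \<Rightarrow> ('l \<Rightarrow> real \<times> real) \<Rightarrow> 'l \<Rightarrow> (real^2) set" where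
  "tile w h s c = half_open_box (corner (s c)) (corner (s c) + corner (w c, h c))"

lemma mem_tile:
  "z \<in> tile w h s c \<longleftrightarrow> fst (s c) \<le> z$1 \<and> z$1 < fst (s c) + w c \<and> snd (s c) \<le> z$2 \<and> z$2 < snd (s c) + h c"
  by (auto simp: tile_def half_open_box_def forall_2)

lemma tile_translate:
  "(\<lambda>z. z + (corner (s' c) - corner (s c))) ` tile w h s c = tile w h s' c"
proof (intro equalityI subsetI)
  fix z assume "z \<in> tile w h s' c"
  then have "z - (corner (s' c) - corner (s c)) \<in> tile w h s c"
    by (auto simp: mem_tile)
  then show "z \<in> (\<lambda>z. z + (corner (s' c) - corner (s c))) ` tile w h s c"
    by (rule rev_image_eqI) simp
qed (auto simp: mem_tile)

lemma tiling_indicator: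
  "(\<Sum>c\<in>L. ind (fst (s c)) (fst (s c) + w c) (z$1) * ind (snd (s c)) (snd (s c) + h c) (z$2))
    = (\<Sum>c\<in>L. of_bool (z \<in> tile w h s c))"
  by (intro sum.cong refl) (simp add: ind_def mem_tile)

lemma tiling_disjoint:
  assumes "finite L" "tiling L w h s X0 X1 Y0 Y1" "c \<in> L" "d \<in> L" "c \<noteq> d"
  shows "tile w h s c \<inter> tile w h s d = {}"
proof (rule ccontr)
  assume "tile w h s c \<inter> tile w h s d \<noteq> {}"
  then obtain z where z: "z \<in> tile w h s c" "z \<in> tile w h s d"
    by blast
  have "(\<Sum>c\<in>L. of_bool (z \<in> tile w h s c) :: real) = ind X0 X1 (z$1) * ind Y0 Y1 (z$2)"
    using assms(2) unfolding tiling_def tiling_indicator[symmetric] by blast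
  then consider "(\<Sum>c\<in>L. of_bool (z \<in> tile w h s c) :: real) = 0"
    | "(\<Sum>c\<in>L. of_bool (z \<in> tile w h s c) :: real) = 1"
    by (cases "X0 \<le> z$1 \<and> z$1 < X1 \<and> Y0 \<le> z$2 \<and> z$2 < Y1") (auto simp: ind_def)
  then show False
  proof cases
    case 1
    then show ?thesis
      using sum_of_bool_eq_0[OF assms(1) 1 assms(3)] z by blast
  next
    case 2
    then show ?thesis
      using sum_of_bool_eq_1[OF assms(1) 2] z assms(3-5) by blast
  qed
qed

lemma tilingI:
  assumes "finite L" "\<And>c d. c \<in> L \<Longrightarrow> d \<in> L \<Longrightarrow> c \<noteq> d \<Longrightarrow> tile w h s c \<inter> tile w h s d = {}"
    and "(\<Union>c\<in>L. tile w h s c) = unit_cube"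
  shows "tiling L w h s 0 1 0 1"
  unfolding tiling_def
proof (intro allI)
  fix u v :: real
  define z where "z = corner (u, v)"
  have "(\<Sum>c\<in>L. of_bool (z \<in> tile w h s c) :: real) = of_bool (z \<in> unit_cube)"
  proof (cases "z \<in> unit_cube")
    case True
    then obtain c where "c \<in> L" "z \<in> tile w h s c"
      using assms(3) by blast
    then have "\<exists>!c. c \<in> L \<and> z \<in> tile w h s c"
      using assms(2) by blast
    then show ?thesis
      using sum_of_bool_ex1[OF assms(1)] True by simp
  next
    case False
    then have "\<And>c. c \<in> L \<Longrightarrow> z \<notin> tile w h s c"
      using assms(3) by blast
    then show ?thesis
      using sum_of_bool_none[of L "\<lambda>c. z \<in> tile w h s c"] False by simp
  qed
  also have "\<dots> = ind 0 1 u * ind 0 1 v"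
    by (auto simp: z_def unit_cube_def half_open_box_def forall_2 ind_def)
  finally show "(\<Sum>c\<in>L. ind (fst (s c)) (fst (s c) + w c) u * ind (snd (s c)) (snd (s c) + h c) v)
      = ind 0 1 u * ind 0 1 v"
    using tiling_indicator[of s w z h L] by (simp add: z_def)
qed

text \<open>Treats both directions \<open>i\<close> at once. Disjointness ensures that the case
  distinction in \<open>rshuffle\<close> leaves every other tile fixed.\<close>

lemma rshuffle_of_boxes:
  assumes disj: "\<And>c d. c \<in> L \<Longrightarrow> d \<in> L \<Longrightarrow> c \<noteq> d \<Longrightarrow> tile w h s c \<inter> tile w h s d = {}"
    and ab: "a \<in> L" "b \<in> L" "a \<noteq> b"
    and boxes: "half_open_box p (upd_vec q i m) = tile w h s a" "half_open_box (upd_vec p i m) q = tile w h s b"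
    and pq: "\<forall>j. p$j < q$j" "p$i < m" "m < q$i"
    and moved: "corner (s' a) = corner (s a) + (q$i - m) *\<^sub>R axis i 1"
      "corner (s' b) = corner (s b) - (m - p$i) *\<^sub>R axis i 1"
    and fixed: "\<And>c. c \<noteq> a \<Longrightarrow> c \<noteq> b \<Longrightarrow> s' c = s c"
  shows "\<exists>r. is_rshuffle_on (tile w h s ` L) r
    \<and> (\<forall>c\<in>L. \<forall>z\<in>tile w h s c. r z = z + (corner (s' c) - corner (s c)))"
proof (intro exI conjI ballI)
  show "is_rshuffle_on (tile w h s ` L) (rshuffle p q i m)"
    unfolding is_rshuffle_on_def using ab boxes pq by blast
  fix c z
  assume c: "c \<in> L" "z \<in> tile w h s c"
  consider "c = a" | "c = b" | "c \<noteq> a" "c \<noteq> b"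
    by blast
  then show "rshuffle p q i m z = z + (corner (s' c) - corner (s c))"
  proof cases
    case 1
    then show ?thesis
      using c moved by (simp add: rshuffle_def boxes)
  next
    case 2
    then have "z \<notin> tile w h s a"
      using c disj[of a b] ab by blast
    then show ?thesis
      using 2 c moved by (simp add: rshuffle_def boxes)
  next
    case 3
    then have "z \<notin> tile w h s a" "z \<notin> tile w h s b"
      using c disj[of a c] disj[of b c] ab by blast+
    then show ?thesis
      using 3 fixed by (simp add: rshuffle_def boxes)
  qed
qed

lemma step_rshuffle:
  assumes L: "finite L" "\<And>c. c \<in> L \<Longrightarrow> w c > 0" "\<And>c. c \<in> L \<Longrightarrow> h c > 0"
    and tile: "tiling L w h s X0 X1 Y0 Y1" and "step L w h s s'"
  shows "\<exists>r. is_rshuffle_on (tile w h s ` L) r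
    \<and> (\<forall>c\<in>L. \<forall>z\<in>tile w h s c. r z = z + (corner (s' c) - corner (s c)))"
  using assms(5) unfolding step_def
proof
  assume "hstep L w h s s'"
  then obtain a b where ab: "a \<in> L" "b \<in> L" "a \<noteq> b"
      and eq: "snd (s a) = snd (s b)" "h a = h b" "fst (s b) = fst (s a) + w a"
      and s': "s' = s(a := (fst (s a) + w b, snd (s a)), b := s a)"
    unfolding hstep_def by blast
  have pos: "w a > 0" "w b > 0" "h a > 0" "h b > 0"
    using L ab by auto
  show ?thesis
  \<comment> \<open>The union of the two tiles runs from the corner of \<open>a\<close> to the far
    corner of \<open>b\<close> and is cut at the left edge of \<open>b\<close>.\<close>
  proof (rule rshuffle_of_boxes[OF tiling_disjoint[OF L(1) tile] ab,
      where p = "corner (s a)" and q = "corner (s b) + corner (w b, h b)" and i = 1 and m = "fst (s b)"])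
    show "half_open_box (corner (s a)) (upd_vec (corner (s b) + corner (w b, h b)) 1 (fst (s b))) = tile w h s a"
      using eq by (auto simp: mem_tile half_open_box_def upd_vec_def forall_2)
    show "half_open_box (upd_vec (corner (s a)) 1 (fst (s b))) (corner (s b) + corner (w b, h b)) = tile w h s b"
      using eq by (auto simp: mem_tile half_open_box_def upd_vec_def forall_2)
  qed (use ab eq pos in \<open>auto simp: s' forall_2 vec_eq_iff axis_def\<close>)
next
  assume "hstep L h w (prod.swap \<circ> s) (prod.swap \<circ> s')"
  then obtain a b where ab: "a \<in> L" "b \<in> L" "a \<noteq> b"
      and eq: "fst (s a) = fst (s b)" "w a = w b" "snd (s b) = snd (s a) + h a"
      and s': "prod.swap \<circ> s' = (prod.swap \<circ> s)(a := (snd (s a) + h b, fst (s a)), b := prod.swap (s a))"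
    unfolding hstep_def by auto
  have s': "s' c = (if c = b then s a else if c = a then (fst (s a), snd (s a) + h b) else s c)" for c
    using fun_cong[OF s', of c] by (auto simp: prod_eq_iff split: if_splits)
  have pos: "w a > 0" "w b > 0" "h a > 0" "h b > 0"
    using L ab by auto
  show ?thesis
  proof (rule rshuffle_of_boxes[OF tiling_disjoint[OF L(1) tile] ab,
      where p = "corner (s a)" and q = "corner (s b) + corner (w b, h b)" and i = 2 and m = "snd (s b)"])
    show "half_open_box (corner (s a)) (upd_vec (corner (s b) + corner (w b, h b)) 2 (snd (s b))) = tile w h s a"
      using eq by (auto simp: mem_tile half_open_box_def upd_vec_def forall_2)
    show "half_open_box (upd_vec (corner (s a)) 2 (snd (s b))) (corner (s b) + corner (w b, h b)) = tile w h s b"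
      using eq by (auto simp: mem_tile half_open_box_def upd_vec_def forall_2)
  qed (use ab eq pos in \<open>auto simp: s' forall_2 vec_eq_iff axis_def\<close>)
qed

lemma comp_seq_Cons: "comp_seq (r # rs) = comp_seq rs \<circ> r"
proof -
  \<comment> \<open>Generalised over the accumulator, as \<open>comp_seq\<close> is a left fold
    whose first map acts first.\<close>
  have "foldl (\<lambda>g r. r \<circ> g) g rs = foldl (\<lambda>g r. r \<circ> g) id rs \<circ> g" for g :: "'a \<Rightarrow> 'a"
  proof (induction rs arbitrary: g)
    case (Cons r rs)
    show ?case
      using Cons.IH[of "r \<circ> g"] Cons.IH[of r] by (simp add: comp_assoc)
  qed simp
  from this[of r] show ?thesis
    by (simp add: comp_seq_def)
qed

text \<open>Induction from the first move, as \<open>rshuffle_seq_on\<close> recurses on the head of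
  the list: the first shuffle turns the tiles of \<open>s\<close> into those of the next
  placement.\<close>

lemma moves_rshuffles:
  assumes "moves L w h s s'" "tiling L w h s X0 X1 Y0 Y1"
    and L: "finite L" "\<And>c. c \<in> L \<Longrightarrow> w c > 0" "\<And>c. c \<in> L \<Longrightarrow> h c > 0"
  shows "\<exists>rs. rshuffle_seq_on (tile w h s ` L) rs
    \<and> (\<forall>c\<in>L. \<forall>z\<in>tile w h s c. comp_seq rs z = z + (corner (s' c) - corner (s c)))"
  using assms(1,2)
proof (induction rule: converse_rtranclp_induct)
  case base
  show ?case
    by (rule exI[of _ "[]"]) (simp add: comp_seq_def)
next
  case (step s t)
  obtain r where r: "is_rshuffle_on (tile w h s ` L) r"
      "\<forall>c\<in>L. \<forall>z\<in>tile w h s c. r z = z + (corner (t c) - corner (s c))"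
    using step_rshuffle[OF L step.prems step.hyps(1)] by blast
  have image: "r ` tile w h s c = tile w h t c" if "c \<in> L" for c
    using r(2) that tile_translate[of t c s w h] by (metis (no_types, lifting) image_cong)
  have "tiling L w h t X0 X1 Y0 Y1"
    using tiling_moves[OF r_into_rtranclp[of "step L w h", OF step.hyps(1)] step.prems L] .
  then obtain rs where rs: "rshuffle_seq_on (tile w h t ` L) rs"
      "\<forall>c\<in>L. \<forall>z\<in>tile w h t c. comp_seq rs z = z + (corner (s' c) - corner (t c))"
    using step.IH by blast
  have "(\<lambda>K. r ` K) ` (tile w h s ` L) = tile w h t ` L"
    using image by (simp add: image_image)
  then have "rshuffle_seq_on (tile w h s ` L) (r # rs)"
    using r(1) rs(1) by simp
  moreover have "comp_seq (r # rs) z = z + (corner (s' c) - corner (s c))"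
    if "c \<in> L" "z \<in> tile w h s c" for c z
  proof -
    have "r z \<in> tile w h t c"
      using image that by blast
    then show ?thesis
      using that r(2) rs(2) by (simp add: comp_seq_Cons)
  qed
  ultimately show ?case
    by blast
qed

section \<open>From the given map to two placements\<close>

lemma measure_proj_half_open_box:
  fixes a b :: "real^'n"
  assumes "\<forall>j. a$j < b$j"
  shows "measure lborel ((\<lambda>x. x$i) ` half_open_box a b) = b$i - a$i"
proof -
  have "(\<lambda>x. x$i) ` half_open_box a b = {a$i..<b$i}"
  proof (intro equalityI subsetI)
    fix t assume "t \<in> {a$i..<b$i}"
    \<comment> \<open>Each point of the interval is attained by changing one coordinate of the lower
      corner \<open>a\<close>.\<close>
    then have "upd_vec a i t \<in> half_open_box a b"
      using assms by (auto simp: half_open_box_def upd_vec_def)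
    then show "t \<in> (\<lambda>x. x$i) ` half_open_box a b"
      by (rule rev_image_eqI) (simp add: upd_vec_def)
  qed (auto simp: half_open_box_def)
  then show ?thesis
    using assms by (simp add: less_imp_le)
qed

text \<open>The rectangles of \<open>P\<close> serve as labels of the tiles; \<open>s\<close> and
  \<open>s'\<close> place them before and after applying \<open>f\<close>. Moving \<open>s\<close>
  to \<open>s'\<close> then translates every rectangle as \<open>f\<close> does.\<close>

theorem mainTheorem18:
  fixes f :: "real^2 \<Rightarrow> real^2" and P :: "(real^2) set set"
  assumes "in_Rec f" and "associated f P" and "setwise_Q_free P"
  shows "\<exists>rs. rshuffle_seq_on P rs \<and> (\<forall>x\<in>unit_cube. f x = comp_seq rs x)"
proof -
  have part: "finite P" "\<And>K. K \<in> P \<Longrightarrow> is_rectangle K" "\<Union>P = unit_cube"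
      "\<And>K L. K \<in> P \<Longrightarrow> L \<in> P \<Longrightarrow> K \<noteq> L \<Longrightarrow> K \<inter> L = {}"
    using assms(2) by (auto simp: associated_def rect_partition_def)
  have "\<forall>K\<in>P. \<exists>v. \<forall>x\<in>K. f x = x + v"
    using assms(2) by (auto simp: associated_def)
  then obtain v where v: "\<And>K x. K \<in> P \<Longrightarrow> x \<in> K \<Longrightarrow> f x = x + v K"
    by metis
  have "\<exists>a b. (\<forall>j. a$j < b$j) \<and> K = half_open_box a b" if "K \<in> P" for K
    using part(2)[OF that] by (simp add: is_rectangle_def)
  then obtain lo hi where box: "\<And>K j. K \<in> P \<Longrightarrow> lo K $ j < hi K $ j"
      "\<And>K. K \<in> P \<Longrightarrow> K = half_open_box (lo K) (hi K)"
    by metis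
  define w where "w K = hi K $ 1 - lo K $ 1" for K
  define h where "h K = hi K $ 2 - lo K $ 2" for K
  define s where "s K = (lo K $ 1, lo K $ 2)" for K
  \<comment> \<open>Outside \<open>P\<close> the two placements must agree, since moves change only
    tiles in \<open>P\<close>.\<close>
  define s' where "s' K = (if K \<in> P then (lo K $ 1 + v K $ 1, lo K $ 2 + v K $ 2) else s K)" for K
  have proj: "measure lborel ((\<lambda>x. x$i) ` K) = hi K $ i - lo K $ i" if "K \<in> P" for K i
    using measure_proj_half_open_box[of "lo K" "hi K" i] box[OF that] by simp
  have indep: "Q_lin_indep ((\<lambda>K. hi K $ i - lo K $ i) ` P)" for i
  proof -
    have "{measure lborel ((\<lambda>x. x$i) ` K) | K. K \<in> P} = (\<lambda>K. measure lborel ((\<lambda>x. x$i) ` K)) ` P"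
      by (rule Setcompr_eq_image)
    also have "\<dots> = (\<lambda>K. hi K $ i - lo K $ i) ` P"
      by (rule image_cong[OF refl proj])
    finally show ?thesis
      using assms(3)[unfolded setwise_Q_free_def, THEN spec, of i] by simp
  qed
  have "Q_lin_indep (w ` P)" "Q_lin_indep (h ` P)"
    using indep[of 1] indep[of 2] by (simp_all add: w_def[abs_def] h_def[abs_def])
  then have sz: "sizes P w h"
    using part(1) box(1) by (auto simp: sizes_def w_def h_def)
  have tile_s: "tile w h s K = K" if "K \<in> P" for K
  proof -
    have "corner (s K) = lo K" "corner (s K) + corner (w K, h K) = hi K"
      by (simp_all add: vec_eq_iff forall_2 s_def w_def h_def)
    then show ?thesis
      using box(2)[OF that] by (simp add: tile_def)
  qed
  have shift: "corner (s' K) - corner (s K) = v K" if "K \<in> P" for K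
    using that by (simp add: vec_eq_iff forall_2 s_def s'_def)
  have tile_s': "tile w h s' K = f ` K" if "K \<in> P" for K
    using tile_translate[of s' K s w h] tile_s[OF that] shift[OF that] v[OF that]
    by (metis (no_types, lifting) image_cong)
  have bij: "bij_betw f unit_cube unit_cube"
    using assms(1) by (simp add: in_Rec_def)
  have "tiling P w h s 0 1 0 1"
    using part tile_s by (intro tilingI) auto
  moreover have "tiling P w h s' 0 1 0 1"
  proof (rule tilingI[OF part(1)])
    fix K L assume KL: "K \<in> P" "L \<in> P" "K \<noteq> L"
    \<comment> \<open>Injectivity of \<open>f\<close> on the cube keeps the images disjoint.\<close>
    have "f ` K \<inter> f ` L = f ` (K \<inter> L)"
      using KL part(3) by (intro inj_on_image_Int[OF bij_betw_imp_inj_on[OF bij], symmetric]) auto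
    then show "tile w h s' K \<inter> tile w h s' L = {}"
      using part(4)[OF KL] tile_s' KL by simp
  next
    show "(\<Union>K\<in>P. tile w h s' K) = unit_cube"
      using tile_s' part(3) bij_betw_imp_surj_on[OF bij] by (simp flip: image_Union)
  qed
  ultimately have "moves P w h s s'" and tile: "tiling P w h s 0 1 0 1"
    using tilings_connected[OF sz] by (auto simp: s'_def)
  then obtain rs where rs: "rshuffle_seq_on (tile w h s ` P) rs"
      "\<forall>K\<in>P. \<forall>z\<in>tile w h s K. comp_seq rs z = z + (corner (s' K) - corner (s K))"
    using moves_rshuffles[OF _ tile sizesD(1-3)[OF sz]] by blast
  have "rshuffle_seq_on P rs"
    using rs(1) tile_s by simp
  moreover have "f x = comp_seq rs x" if x: "x \<in> unit_cube" for x
  proof -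
    obtain K where K: "K \<in> P" "x \<in> K"
      using x part(3) by blast
    then show ?thesis
      using rs(2) tile_s shift v by simp
  qed
  ultimately show ?thesis
    by blast
qed

end
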